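(* Let $A$ be an associative unital algebra over $\mathbb C$ and let $B\subset A$ be a subalgebra with a character $\varepsilon:B\to\mathbb C$. Then the algebra $Hk^0(A,B)^{opp}$ satisfies Dirac's condition for every representation $V$ of $A$. That is, let a class in $Hk^0(A,B)$ be represented by a degree-zero cocycle $f\in\mathrm{End}_A(A\otimes_BX)$, where $X$ is a projective resolution of the left $B$-module $\mathbb C$ with $X_0=B$ and augmentation $\varepsilon$, and let $a\in A$ be the element representing the $(0,0)$-component of $f$. Then for every left $A$-module $V$ the class acts on $V^B$ by $v\mapsto av$, and $$[b,a]v=0\quad\text{for every } b\in B,\ v\in V^B .$$
   Context: For a left $A$-module $V$, $V^B=\{v\in V: bv=\varepsilon(b)v\text{ for every }b\in B\}$, i.e. $V^B=H^0(V)=\mathrm{Hom}_B(\mathbb C,V)$, where $\mathbb C$ is a left $B$-module via $\varepsilon$ and $H^*(V)=\mathrm{Ext}_B^*(\mathbb C,V)$. Dirac's condition on $a\in A$ (the condition for $a$ to be an observable of the reduced system with space of physical states $V^B$) is $[b,a]v=0$ for every $b\in B$, $v\in V^B$, where $[b,a]=ba-ab$; equivalently $bav=\varepsilon(b)av$. For a complex $Z=\{Z^p\}$ of left $A$-modules with differential $d:Z^p\to Z^{p-1}$, the graded algebra $\mathrm{End}_A(Z)$ has degree-$n$ component $\prod_p\mathrm{Hom}_A(Z^p,Z^{p-n})$, product given by composition, and differential $\mathbf d f=d\circ f-(-1)^{\deg(f)}f\circ d$. The Hecke algebra is $Hk^*(A,B)=H^*(\mathrm{End}_A(A\otimes_BX))$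 with $X$ a projective resolution of the left $B$-module $\mathbb C$; it is a graded associative algebra independent of $X$. One can take $X$ with $X_0=B$ and augmentation $\varepsilon:B\to\mathbb C$, for instance the bar resolution; then $A\otimes_BX_0=A$. The $(0,0)$-component of a degree-zero element $f$ is its component $f^{0,0}\in\mathrm{Hom}_A(A\otimes_BX_0,A\otimes_BX_0)=\mathrm{Hom}_A(A,A)$, which is right multiplication by the element $a=f^{0,0}(1)\in A$. The composition action $(\varphi,f)\mapsto\varphi\circ f$ of $\mathrm{End}_A(A\otimes_BX)$ on $\mathrm{Hom}_A(A\otimes_BX,V)=\mathrm{Hom}_B(X,V)$ induces a right action of $Hk^0(A,B)$ on $H^0(V)=V^B$, that is, a left action of $Hk^0(A,B)^{opp}$. Here $v\in V^B$ corresponds to the degree-zero cocycle $\varphi:A=A\otimes_BX_0\to V$, $\varphi(x)=xv$. *)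

theory Defs
  imports Complex_Main "HOL-Algebra.Subrings" "HOL-Algebra.Module" "HOL-Algebra.Free_Abelian_Groups"
begin

section \<open>Algebras, subalgebras, characters, left modules\<close>

text \<open>The library locales \<open>algebra\<close> and \<open>module\<close> require a commutative algebra and
  a commutative base ring, respectively; here are the versions without commutativity.\<close>

locale associative_algebra = module + ring M +
  assumes smult_mult_left:
      "\<lbrakk>c \<in> carrier R; x \<in> carrier M; y \<in> carrier M\<rbrakk> \<Longrightarrow>
        (c \<odot>\<^bsub>M\<^esub> x) \<otimes>\<^bsub>M\<^esub> y = c \<odot>\<^bsub>M\<^esub> (x \<otimes>\<^bsub>M\<^esub> y)"
    and smult_mult_right:
      "\<lbrakk>c \<in> carrier R; x \<in> carrier M; y \<in> carrier M\<rbrakk> \<Longrightarrow>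
        x \<otimes>\<^bsub>M\<^esub> (c \<odot>\<^bsub>M\<^esub> y) = c \<odot>\<^bsub>M\<^esub> (x \<otimes>\<^bsub>M\<^esub> y)"

definition complex_ring :: "complex ring" where
  "complex_ring = \<lparr>carrier = UNIV, mult = (*), one = 1, ring.zero = 0, add = (+)\<rparr>"

abbreviation complex_algebra :: "(complex, 'a) module \<Rightarrow> bool" where
  "complex_algebra A \<equiv> associative_algebra complex_ring A"

text \<open>\<^const>\<open>subring\<close> includes that \<open>B\<close> contains the unit of \<open>A\<close>.\<close>

definition complex_subalgebra :: "'a set \<Rightarrow> (complex, 'a) module \<Rightarrow> bool" where
  "complex_subalgebra B A \<longleftrightarrow> subring B A \<and> (\<forall>c. \<forall>b\<in>B. c \<odot>\<^bsub>A\<^esub> b \<in> B)"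

definition character :: "(complex, 'a) module \<Rightarrow> 'a set \<Rightarrow> ('a \<Rightarrow> complex) \<Rightarrow> bool" where
  "character A B \<epsilon> \<longleftrightarrow>
     \<epsilon> \<in> ring_hom (A\<lparr>carrier := B\<rparr>) complex_ring \<and>
     (\<forall>c. \<forall>b\<in>B. \<epsilon> (c \<odot>\<^bsub>A\<^esub> b) = c * \<epsilon> b)"

text \<open>As for \<^const>\<open>module\<close>, the fields \<open>mult\<close> and \<open>one\<close> of the record \<open>M\<close> are ignored.
  A left module over a complex algebra is a vector space through \<open>c \<mapsto> c \<odot> \<one>\<close>, and
  module homomorphisms are automatically linear.\<close>

locale left_module = R?: ring R + M?: abelian_group M
  for R :: "('a, 'r) ring_scheme" (structure) and M :: "('a, 'm) module" (structure) +
  assumes smult_closed [simp, intro]: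
      "\<lbrakk>a \<in> carrier R; x \<in> carrier M\<rbrakk> \<Longrightarrow> a \<odot>\<^bsub>M\<^esub> x \<in> carrier M"
    and smult_l_distr:
      "\<lbrakk>a \<in> carrier R; b \<in> carrier R; x \<in> carrier M\<rbrakk> \<Longrightarrow>
        (a \<oplus> b) \<odot>\<^bsub>M\<^esub> x = a \<odot>\<^bsub>M\<^esub> x \<oplus>\<^bsub>M\<^esub> b \<odot>\<^bsub>M\<^esub> x"
    and smult_r_distr:
      "\<lbrakk>a \<in> carrier R; x \<in> carrier M; y \<in> carrier M\<rbrakk> \<Longrightarrow>
        a \<odot>\<^bsub>M\<^esub> (x \<oplus>\<^bsub>M\<^esub> y) = a \<odot>\<^bsub>M\<^esub> x \<oplus>\<^bsub>M\<^esub> a \<odot>\<^bsub>M\<^esub> y"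
    and smult_assoc1:
      "\<lbrakk>a \<in> carrier R; b \<in> carrier R; x \<in> carrier M\<rbrakk> \<Longrightarrow>
        (a \<otimes> b) \<odot>\<^bsub>M\<^esub> x = a \<odot>\<^bsub>M\<^esub> (b \<odot>\<^bsub>M\<^esub> x)"
    and smult_one [simp]:
      "x \<in> carrier M \<Longrightarrow> \<one> \<odot>\<^bsub>M\<^esub> x = x"

text \<open>Homomorphisms are extensional functions, so that equality of homomorphisms is
  equality of functions.\<close>

definition mod_hom ::
  "('a, 'r) ring_scheme \<Rightarrow> ('a, 'm) module \<Rightarrow> ('a, 'n) module \<Rightarrow> ('m \<Rightarrow> 'n) set" where
  "mod_hom R M N = {h \<in> carrier M \<rightarrow>\<^sub>E carrier N.
     (\<forall>x\<in>carrier M. \<forall>y\<in>carrier M. h (x \<oplus>\<^bsub>M\<^esub> y) = h x \<oplus>\<^bsub>N\<^esub> h y) \<and>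
     (\<forall>r\<in>carrier R. \<forall>x\<in>carrier M. h (r \<odot>\<^bsub>M\<^esub> x) = r \<odot>\<^bsub>N\<^esub> h x)}"

definition mod_iso ::
  "('a, 'r) ring_scheme \<Rightarrow> ('a, 'm) module \<Rightarrow> ('a, 'n) module \<Rightarrow> ('m \<Rightarrow> 'n) set" where
  "mod_iso R M N = {h \<in> mod_hom R M N. bij_betw h (carrier M) (carrier N)}"

definition regular_module :: "('a, 'r) ring_scheme \<Rightarrow> ('a, 'a) module" where
  "regular_module R = \<lparr>carrier = carrier R, mult = mult R, one = one R,
     ring.zero = ring.zero R, add = add R, smult = mult R\<rparr>"

definition character_module :: "('a \<Rightarrow> complex) \<Rightarrow> ('a, complex) module" where
  "character_module \<epsilon> = \<lparr>carrier = UNIV, mult = (*), one = 1, ring.zero = 0, add = (+),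
     smult = (\<lambda>b z. \<epsilon> b * z)\<rparr>"


section \<open>Projective modules and resolutions\<close>

definition lifts ::
  "('a, 'r) ring_scheme \<Rightarrow> ('a, 'x) module \<Rightarrow> ('a, 'm) module \<Rightarrow> ('a, 'n) module \<Rightarrow> bool" where
  "lifts R P M N \<longleftrightarrow> (\<forall>g\<in>mod_hom R M N. \<forall>h\<in>mod_hom R P N.
     g ` carrier M = carrier N \<longrightarrow> (\<exists>k\<in>mod_hom R P M. compose (carrier P) g k = h))"

text \<open>A definition cannot quantify over types, so the lifting property is required for test
  modules of two particular types. They are large enough to contain \<open>P\<close> and the free module
  on \<open>carrier P\<close>, and therefore the lifting property follows for test modules of all types:
  see \<open>projective_module_lifts\<close> below.\<close>

definition projective_module :: "('a, 'r) ring_scheme \<Rightarrow> ('a, 'x) module \<Rightarrow> bool" where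
  "projective_module R P \<longleftrightarrow> left_module R P \<and>
     (\<forall>(M :: ('a, 'x \<Rightarrow> 'a) module) (N :: ('a, 'x) module).
        left_module R M \<longrightarrow> left_module R N \<longrightarrow> lifts R P M N)"

definition free_module :: "('a, 'r) ring_scheme \<Rightarrow> 'x set \<Rightarrow> ('a, 'x \<Rightarrow> 'a) module" where
  "free_module R S = \<lparr>carrier = {u. (\<forall>x. u x \<in> carrier R) \<and> {x. u x \<noteq> \<zero>\<^bsub>R\<^esub>} \<subseteq> S \<and>
       finite {x. u x \<noteq> \<zero>\<^bsub>R\<^esub>}},
     mult = undefined, one = undefined, ring.zero = (\<lambda>x. \<zero>\<^bsub>R\<^esub>),
     add = (\<lambda>u w x. u x \<oplus>\<^bsub>R\<^esub> w x), smult = (\<lambda>r u x. r \<otimes>\<^bsub>R\<^esub> u x)\<rparr>"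

definition free_ext ::
  "('a, 'r) ring_scheme \<Rightarrow> 'x set \<Rightarrow> ('a, 'm) module \<Rightarrow> ('x \<Rightarrow> 'm) \<Rightarrow> ('x \<Rightarrow> 'a) \<Rightarrow> 'm" where
  "free_ext R S M m = (\<lambda>u\<in>carrier (free_module R S).
     finsum M (\<lambda>x. u x \<odot>\<^bsub>M\<^esub> m x) {x. u x \<noteq> \<zero>\<^bsub>R\<^esub>})"

lemma (in left_module) smult_zero_left [simp]:
  assumes "x \<in> carrier M" shows "\<zero> \<odot>\<^bsub>M\<^esub> x = \<zero>\<^bsub>M\<^esub>"
proof -
  have "\<zero> \<odot>\<^bsub>M\<^esub> x \<oplus>\<^bsub>M\<^esub> \<zero> \<odot>\<^bsub>M\<^esub> x = \<zero> \<odot>\<^bsub>M\<^esub> x"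
    using assms smult_l_distr[of \<zero> \<zero> x] by simp
  then show ?thesis using assms by (simp add: M.add.l_cancel_one)
qed

lemma (in left_module) smult_zero_right [simp]:
  assumes "r \<in> carrier R" shows "r \<odot>\<^bsub>M\<^esub> \<zero>\<^bsub>M\<^esub> = \<zero>\<^bsub>M\<^esub>"
proof -
  have "r \<odot>\<^bsub>M\<^esub> \<zero>\<^bsub>M\<^esub> \<oplus>\<^bsub>M\<^esub> r \<odot>\<^bsub>M\<^esub> \<zero>\<^bsub>M\<^esub> = r \<odot>\<^bsub>M\<^esub> \<zero>\<^bsub>M\<^esub>"
    using assms smult_r_distr[of r "\<zero>\<^bsub>M\<^esub>" "\<zero>\<^bsub>M\<^esub>"] by simp
  then show ?thesis using assms by (simp add: M.add.l_cancel_one)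
qed

lemma (in left_module) smult_finsum:
  assumes "finite T" "r \<in> carrier R" "\<And>x. x \<in> T \<Longrightarrow> m x \<in> carrier M"
  shows "r \<odot>\<^bsub>M\<^esub> finsum M m T = finsum M (\<lambda>x. r \<odot>\<^bsub>M\<^esub> m x) T"
  using assms by (induction T rule: finite_induct) (auto simp: smult_r_distr Pi_def)

lemma free_module_left_module:
  fixes R :: "('a, 'r) ring_scheme" (structure) and S :: "'x set"
  assumes "ring R" shows "left_module R (free_module R S)"
proof -
  interpret ring R by fact
  have fin_add: "finite {x. u x \<oplus> w x \<noteq> \<zero>}"
    if "finite {x. u x \<noteq> \<zero>}" "finite {x. w x \<noteq> \<zero>}" for u w :: "'x \<Rightarrow> 'a"
    by (rule finite_subset[OF _ finite_UnI[OF that]]) auto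
  have fin_smult: "finite {x. r \<otimes> u x \<noteq> \<zero>}"
    if "finite {x. u x \<noteq> \<zero>}" "r \<in> carrier R" for r and u :: "'x \<Rightarrow> 'a"
    by (rule finite_subset[OF _ that(1)]) (use that in auto)
  have "abelian_group (free_module R S)"
  proof (rule abelian_groupI)
    fix u assume u: "u \<in> carrier (free_module R S)"
    have "(\<lambda>x. \<ominus> u x) \<in> carrier (free_module R S)"
      using u by (auto simp: free_module_def elim!: rev_finite_subset)
    moreover have "(\<lambda>x. \<ominus> u x) \<oplus>\<^bsub>free_module R S\<^esub> u = \<zero>\<^bsub>free_module R S\<^esub>"
      using u by (auto simp: free_module_def l_neg)
    ultimately show "\<exists>w\<in>carrier (free_module R S). w \<oplus>\<^bsub>free_module R S\<^esub> u = \<zero>\<^bsub>free_module R S\<^esub>"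
      by blast
  next
    show "u \<oplus>\<^bsub>free_module R S\<^esub> w \<in> carrier (free_module R S)"
      if "u \<in> carrier (free_module R S)" "w \<in> carrier (free_module R S)" for u w
    proof -
      have "{x. u x \<oplus> w x \<noteq> \<zero>} \<subseteq> {x. u x \<noteq> \<zero>} \<union> {x. w x \<noteq> \<zero>}" by auto
      then show ?thesis using that fin_add[of u w] by (auto simp: free_module_def)
    qed
  qed (auto simp: free_module_def a_ac)
  then interpret F: abelian_group "free_module R S" .
  show ?thesis
  proof unfold_locales
    show "r \<odot>\<^bsub>free_module R S\<^esub> u \<in> carrier (free_module R S)"
      if "r \<in> carrier R" "u \<in> carrier (free_module R S)" for r u
    proof -
      have "{x. r \<otimes> u x \<noteq> \<zero>} \<subseteq> {x. u x \<noteq> \<zero>}" using that by auto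
      then show ?thesis using that fin_smult[of u r] by (auto simp: free_module_def)
    qed
  qed (auto simp: free_module_def l_distr r_distr m_assoc)
qed

context left_module
begin

lemma free_ext_superset:
  assumes "u \<in> carrier (free_module R S)" "m \<in> S \<rightarrow> carrier M"
    and "finite T" "{x. u x \<noteq> \<zero>} \<subseteq> T" "T \<subseteq> S"
  shows "free_ext R S M m u = finsum M (\<lambda>x. u x \<odot>\<^bsub>M\<^esub> m x) T"
proof -
  have "finsum M (\<lambda>x. u x \<odot>\<^bsub>M\<^esub> m x) {x. u x \<noteq> \<zero>} = finsum M (\<lambda>x. u x \<odot>\<^bsub>M\<^esub> m x) T"
    by (rule M.add.finprod_mono_neutral_cong_left)
      (use assms in \<open>auto simp: free_module_def Pi_def intro!: smult_zero_left\<close>)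
  then show ?thesis using assms by (simp add: free_ext_def)
qed

lemma free_ext_hom:
  assumes m: "m \<in> S \<rightarrow> carrier M"
  shows "free_ext R S M m \<in> mod_hom R (free_module R S) M"
proof -
  interpret F: left_module R "free_module R S"
    by (rule free_module_left_module) unfold_locales
  have cl: "free_ext R S M m u \<in> carrier M" if "u \<in> carrier (free_module R S)" for u
    using that m by (auto simp: free_ext_def free_module_def intro!: M.finsum_closed)
  have add: "free_ext R S M m (u \<oplus>\<^bsub>free_module R S\<^esub> w)
      = free_ext R S M m u \<oplus>\<^bsub>M\<^esub> free_ext R S M m w"
    if u: "u \<in> carrier (free_module R S)" and w: "w \<in> carrier (free_module R S)" for u w
  proof -
    define T where "T = {x. u x \<noteq> \<zero>} \<union> {x. w x \<noteq> \<zero>}"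
    have T: "finite T" "T \<subseteq> S" "{x. u x \<noteq> \<zero>} \<subseteq> T" "{x. w x \<noteq> \<zero>} \<subseteq> T"
      using u w by (auto simp: T_def free_module_def)
    have uw: "u x \<in> carrier R" "w x \<in> carrier R" for x
      using u w by (auto simp: free_module_def)
    have eq: "(u \<oplus>\<^bsub>free_module R S\<^esub> w) x = u x \<oplus> w x" for x
      by (simp add: free_module_def)
    have "{x. (u \<oplus>\<^bsub>free_module R S\<^esub> w) x \<noteq> \<zero>} \<subseteq> T"
      unfolding eq by (auto simp: T_def)
    then have "free_ext R S M m (u \<oplus>\<^bsub>free_module R S\<^esub> w)
        = finsum M (\<lambda>x. (u x \<oplus> w x) \<odot>\<^bsub>M\<^esub> m x) T"
      using free_ext_superset[OF F.add.m_closed[OF u w] m T(1) _ T(2)] by (simp add: eq)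
    also have "\<dots> = finsum M (\<lambda>x. u x \<odot>\<^bsub>M\<^esub> m x \<oplus>\<^bsub>M\<^esub> w x \<odot>\<^bsub>M\<^esub> m x) T"
      using T m by (intro M.finsum_cong') (auto simp: uw smult_l_distr Pi_def)
    also have "\<dots> = free_ext R S M m u \<oplus>\<^bsub>M\<^esub> free_ext R S M m w"
      using T m by (subst M.finsum_addf)
        (auto simp: uw Pi_def free_ext_superset[OF u m T(1,3,2)] free_ext_superset[OF w m T(1,4,2)])
    finally show ?thesis .
  qed
  have smult: "free_ext R S M m (r \<odot>\<^bsub>free_module R S\<^esub> u) = r \<odot>\<^bsub>M\<^esub> free_ext R S M m u"
    if u: "u \<in> carrier (free_module R S)" and r: "r \<in> carrier R" for u r
  proof -
    define T where "T = {x. u x \<noteq> \<zero>}"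
    have T: "finite T" "T \<subseteq> S" "{x. u x \<noteq> \<zero>} \<subseteq> T"
      using u by (auto simp: T_def free_module_def)
    have ux: "u x \<in> carrier R" for x
      using u by (auto simp: free_module_def)
    have eq: "(r \<odot>\<^bsub>free_module R S\<^esub> u) x = r \<otimes> u x" for x
      by (simp add: free_module_def)
    have "{x. (r \<odot>\<^bsub>free_module R S\<^esub> u) x \<noteq> \<zero>} \<subseteq> T"
      unfolding eq using r by (auto simp: T_def)
    then have "free_ext R S M m (r \<odot>\<^bsub>free_module R S\<^esub> u)
        = finsum M (\<lambda>x. (r \<otimes> u x) \<odot>\<^bsub>M\<^esub> m x) T"
      using free_ext_superset[OF F.smult_closed[OF r u] m T(1) _ T(2)] by (simp add: eq)
    also have "\<dots> = finsum M (\<lambda>x. r \<odot>\<^bsub>M\<^esub> (u x \<odot>\<^bsub>M\<^esub> m x)) T"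
      using T m r by (intro M.finsum_cong') (auto simp: ux smult_assoc1 Pi_def subset_iff)
    also have "\<dots> = r \<odot>\<^bsub>M\<^esub> free_ext R S M m u"
      using T m r by (subst smult_finsum[symmetric])
        (auto simp: ux Pi_def free_ext_superset[OF u m T(1,3,2)])
    finally show ?thesis .
  qed
  have "free_ext R S M m \<in> carrier (free_module R S) \<rightarrow>\<^sub>E carrier M"
    using cl by (auto simp: free_ext_def)
  with add smult show ?thesis by (auto simp: mod_hom_def)
qed

lemma finsum_hom:
  assumes N: "left_module R N" and h: "h \<in> mod_hom R M N"
    and "finite T" "u \<in> T \<rightarrow> carrier R" "m \<in> T \<rightarrow> carrier M"
  shows "h (finsum M (\<lambda>x. u x \<odot>\<^bsub>M\<^esub> m x) T) = finsum N (\<lambda>x. u x \<odot>\<^bsub>N\<^esub> h (m x)) T"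
proof -
  interpret N: left_module R N by fact
  have hom: "h (x \<oplus>\<^bsub>M\<^esub> y) = h x \<oplus>\<^bsub>N\<^esub> h y" "h (r \<odot>\<^bsub>M\<^esub> x) = r \<odot>\<^bsub>N\<^esub> h x" "h x \<in> carrier N"
    if "x \<in> carrier M" "y \<in> carrier M" "r \<in> carrier R" for x y r
    using that h by (auto simp: mod_hom_def)
  have "h \<zero>\<^bsub>M\<^esub> = h (\<zero> \<odot>\<^bsub>M\<^esub> \<zero>\<^bsub>M\<^esub>)" by simp
  also have "\<dots> = \<zero>\<^bsub>N\<^esub>" using hom[of "\<zero>\<^bsub>M\<^esub>" "\<zero>\<^bsub>M\<^esub>" \<zero>] by simp
  finally have zero: "h \<zero>\<^bsub>M\<^esub> = \<zero>\<^bsub>N\<^esub>" .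
  show ?thesis using assms(3-)
  proof (induction T rule: finite_induct)
    case empty
    then show ?case by (simp add: zero)
  next
    case (insert y T)
    have cl: "m y \<in> carrier M" "u y \<in> carrier R" "u \<in> T \<rightarrow> carrier R" "m \<in> T \<rightarrow> carrier M"
      using insert.prems by auto
    have 1: "(\<lambda>x. u x \<odot>\<^bsub>M\<^esub> m x) \<in> T \<rightarrow> carrier M" using cl by auto
    have hcl: "h x \<in> carrier N" if "x \<in> carrier M" for x
      using hom(3)[OF that that R.zero_closed] .
    have 2: "(\<lambda>x. u x \<odot>\<^bsub>N\<^esub> h (m x)) \<in> T \<rightarrow> carrier N" using cl hcl by auto
    show ?case
      using insert.hyps insert.IH[OF cl(3,4)] cl 1 2 hcl
        hom(1)[OF smult_closed[OF cl(2,1)] M.finsum_closed[OF 1] cl(2)]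
        hom(2)[OF cl(1,1,2)]
      by simp
  qed
qed

end

lemma projective_module_lifts:
  fixes P :: "('a, 'x) module" and M :: "('a, 'm) module" and N :: "('a, 'n) module"
  assumes P: "projective_module R P" and M: "left_module R M" and N: "left_module R N"
  shows "lifts R P M N"
  unfolding lifts_def
proof (intro ballI impI)
  fix g h assume g: "g \<in> mod_hom R M N" and h: "h \<in> mod_hom R P N"
    and surj: "g ` carrier M = carrier N"
  interpret P: left_module R P using P by (simp add: projective_module_def)
  interpret M: left_module R M by fact
  interpret N: left_module R N by fact
  let ?S = "carrier P"
  let ?F = "free_module R ?S"
  let ?e = "free_ext R ?S P (\<lambda>x. x)"
  have F: "left_module R ?F" by (rule free_module_left_module) unfold_locales
  have e: "?e \<in> mod_hom R ?F P" by (rule P.free_ext_hom) auto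
  have "?e ` carrier ?F = carrier P"
  proof
    show "?e ` carrier ?F \<subseteq> carrier P" using e by (auto simp: mod_hom_def)
    show "carrier P \<subseteq> ?e ` carrier ?F"
    proof
      fix x assume x: "x \<in> carrier P"
      let ?u = "\<lambda>y. if y = x then \<one>\<^bsub>R\<^esub> else \<zero>\<^bsub>R\<^esub>"
      have u: "?u \<in> carrier ?F"
        using x by (auto simp: free_module_def)
      have "?e ?u = finsum P (\<lambda>y. ?u y \<odot>\<^bsub>P\<^esub> y) {x}"
        by (rule P.free_ext_superset[OF u]) (use x in auto)
      also have "\<dots> = x" using x by simp
      finally show "x \<in> ?e ` carrier ?F" using u by (metis imageI)
    qed
  qed
  moreover have "restrict (\<lambda>x. x) ?S \<in> mod_hom R P P" by (auto simp: mod_hom_def)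
  moreover have "lifts R P ?F P"
    using P F P.left_module_axioms by (auto simp: projective_module_def)
  ultimately obtain s where s: "s \<in> mod_hom R P ?F"
    and es: "compose (carrier P) ?e s = restrict (\<lambda>x. x) ?S"
    using e unfolding lifts_def by blast
  have "\<forall>x\<in>?S. \<exists>y\<in>carrier M. g y = h x"
    using surj h by (auto simp: mod_hom_def PiE_iff image_iff) (metis imageE)
  then obtain m where m: "m \<in> ?S \<rightarrow> carrier M" and gm: "\<And>x. x \<in> ?S \<Longrightarrow> g (m x) = h x"
    by (metis Pi_I)
  let ?k = "free_ext R ?S M m"
  have k: "?k \<in> mod_hom R ?F M" by (rule M.free_ext_hom[OF m])
  have gk: "g (?k u) = h (?e u)" if u: "u \<in> carrier ?F" for u
  proof -
    let ?T = "{x. u x \<noteq> \<zero>\<^bsub>R\<^esub>}"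
    have T: "finite ?T" "?T \<subseteq> ?S" "u \<in> ?T \<rightarrow> carrier R"
      using u by (auto simp: free_module_def)
    have "g (?k u) = finsum N (\<lambda>x. u x \<odot>\<^bsub>N\<^esub> g (m x)) ?T"
      using M.finsum_hom[OF N g T(1,3), of m] m T(2) u by (auto simp: free_ext_def)
    also have "\<dots> = finsum N (\<lambda>x. u x \<odot>\<^bsub>N\<^esub> h x) ?T"
      using T h by (intro N.finsum_cong') (auto simp: gm mod_hom_def subset_iff)
    also have "\<dots> = h (?e u)"
      using P.finsum_hom[OF N h T(1,3), of "\<lambda>x. x"] T(2) u by (simp add: free_ext_def Pi_def subset_iff)
    finally show ?thesis .
  qed
  have sF: "s x \<in> carrier ?F" if "x \<in> ?S" for x
    using s that by (auto simp: mod_hom_def)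
  have "compose ?S ?k s \<in> mod_hom R P M"
    using s k sF by (simp add: mod_hom_def compose_def PiE_iff)
  moreover have "compose ?S g (compose ?S ?k s) = h"
  proof
    fix x show "compose ?S g (compose ?S ?k s) x = h x"
    proof (cases "x \<in> ?S")
      case True
      have "?e (s x) = compose ?S ?e s x" by (simp only: compose_eq[OF True])
      also have "\<dots> = x" using True by (simp only: es restrict_apply if_True)
      finally have "g (?k (s x)) = h x" using gk[OF sF[OF True]] by metis
      then show ?thesis by (simp only: compose_eq[OF True])
    next
      case False
      have "h \<in> ?S \<rightarrow>\<^sub>E carrier N" using h by (simp add: mod_hom_def)
      from PiE_arb[OF this False] have "h x = undefined" .
      then show ?thesis by (simp only: compose_def restrict_apply False if_False)
    qed
  qed
  ultimately show "\<exists>k\<in>mod_hom R P M. compose ?S g k = h" by blast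
qed

text \<open>Complexes are indexed by all integers; a resolution vanishes in negative degrees.\<close>

locale projective_resolution =
  fixes R :: "('a, 'r) ring_scheme"
    and K :: "('a, 'k) module"
    and X :: "int \<Rightarrow> ('a, 'x) module"
    and d :: "int \<Rightarrow> 'x \<Rightarrow> 'x"
    and aug :: "'x \<Rightarrow> 'k"
  assumes resolved_module: "left_module R K"
    and projective: "projective_module R (X p)"
    and negative: "p < 0 \<Longrightarrow> carrier (X p) = {\<zero>\<^bsub>X p\<^esub>}"
    and differential: "d p \<in> mod_hom R (X p) (X (p - 1))"
    and augmentation: "aug \<in> mod_hom R (X 0) K"
    and augmentation_surj: "aug ` carrier (X 0) = carrier K"
    and exact_0: "d 1 ` carrier (X 1) = {x \<in> carrier (X 0). aug x = \<zero>\<^bsub>K\<^esub>}"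
    and exact: "p \<ge> 1 \<Longrightarrow>
      d (p + 1) ` carrier (X (p + 1)) = {x \<in> carrier (X p). d p x = \<zero>\<^bsub>X (p - 1)\<^esub>}"


section \<open>The tensor product \<open>A \<otimes>\<^sub>B X\<close>\<close>

text \<open>For a subring \<open>B\<close> of \<open>A\<close> and a left \<open>B\<close>-module \<open>X\<close>: the free abelian group on
  \<open>A \<times> X\<close> modulo the subgroup generated by the bilinearity and balancing relations.\<close>

abbreviation tensor_free ::
  "('a, 'r) ring_scheme \<Rightarrow> ('a, 'x) module \<Rightarrow> (('a \<times> 'x) \<Rightarrow>\<^sub>0 int) monoid" where
  "tensor_free A X \<equiv> free_Abelian_group (carrier A \<times> carrier X)"

definition tensor_relations ::
  "('a, 'r) ring_scheme \<Rightarrow> 'a set \<Rightarrow> ('a, 'x) module \<Rightarrow> (('a \<times> 'x) \<Rightarrow>\<^sub>0 int) set" where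
  "tensor_relations A B X = generate (tensor_free A X)
    ({frag_of (a \<oplus>\<^bsub>A\<^esub> a', x) - (frag_of (a, x) + frag_of (a', x)) | a a' x.
        a \<in> carrier A \<and> a' \<in> carrier A \<and> x \<in> carrier X} \<union>
     {frag_of (a, x \<oplus>\<^bsub>X\<^esub> x') - (frag_of (a, x) + frag_of (a, x')) | a x x'.
        a \<in> carrier A \<and> x \<in> carrier X \<and> x' \<in> carrier X} \<union>
     {frag_of (a \<otimes>\<^bsub>A\<^esub> b, x) - frag_of (a, b \<odot>\<^bsub>X\<^esub> x) | a b x.
        a \<in> carrier A \<and> b \<in> B \<and> x \<in> carrier X})"

definition tensor_class ::
  "('a, 'r) ring_scheme \<Rightarrow> 'a set \<Rightarrow> ('a, 'x) module \<Rightarrow> (('a \<times> 'x) \<Rightarrow>\<^sub>0 int) \<Rightarrow>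
    (('a \<times> 'x) \<Rightarrow>\<^sub>0 int) set" where
  "tensor_class A B X u = tensor_relations A B X #>\<^bsub>tensor_free A X\<^esub> u"

definition pure_tensor ::
  "('a, 'r) ring_scheme \<Rightarrow> 'a set \<Rightarrow> ('a, 'x) module \<Rightarrow> 'a \<Rightarrow> 'x \<Rightarrow>
    (('a \<times> 'x) \<Rightarrow>\<^sub>0 int) set" where
  "pure_tensor A B X a x = tensor_class A B X (frag_of (a, x))"

text \<open>Here and below, a map on cosets which is well defined by a formula on representatives is
  written as the union of the (equal) values over all representatives.\<close>

definition tensor_module ::
  "('a, 'r) ring_scheme \<Rightarrow> 'a set \<Rightarrow> ('a, 'x) module \<Rightarrow>
    ('a, (('a \<times> 'x) \<Rightarrow>\<^sub>0 int) set) module" where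
  "tensor_module A B X =
    (let Q = tensor_free A X Mod tensor_relations A B X in
     \<lparr>carrier = carrier Q, mult = undefined, one = undefined,
      ring.zero = \<one>\<^bsub>Q\<^esub>, add = mult Q,
      smult = (\<lambda>a U. \<Union>u\<in>U. tensor_class A B X
        (frag_extend (\<lambda>(a', x). frag_of (a \<otimes>\<^bsub>A\<^esub> a', x)) u))\<rparr>)"

definition tensor_map ::
  "('a, 'r) ring_scheme \<Rightarrow> 'a set \<Rightarrow> ('a, 'x) module \<Rightarrow> ('a, 'y) module \<Rightarrow> ('x \<Rightarrow> 'y) \<Rightarrow>
    (('a \<times> 'x) \<Rightarrow>\<^sub>0 int) set \<Rightarrow> (('a \<times> 'y) \<Rightarrow>\<^sub>0 int) set" where
  "tensor_map A B X Y g = (\<lambda>U\<in>carrier (tensor_module A B X).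
     \<Union>u\<in>U. tensor_class A B Y (frag_extend (\<lambda>(a, x). frag_of (a, g x)) u))"


section \<open>Cohomology, and the complexes \<open>End\<^sub>A(Z)\<close> and \<open>Hom\<^sub>A(Z, V)\<close>\<close>

definition cocycles ::
  "(int \<Rightarrow> 'c monoid) \<Rightarrow> (int \<Rightarrow> 'c \<Rightarrow> 'c) \<Rightarrow> int \<Rightarrow> 'c set" where
  "cocycles C \<delta> n = kernel (C n) (C (n + 1)) (\<delta> n)"

definition coboundaries ::
  "(int \<Rightarrow> 'c monoid) \<Rightarrow> (int \<Rightarrow> 'c \<Rightarrow> 'c) \<Rightarrow> int \<Rightarrow> 'c set" where
  "coboundaries C \<delta> n = \<delta> (n - 1) ` carrier (C (n - 1))"

definition cohomology ::
  "(int \<Rightarrow> 'c monoid) \<Rightarrow> (int \<Rightarrow> 'c \<Rightarrow> 'c) \<Rightarrow> int \<Rightarrow> 'c set monoid" where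
  "cohomology C \<delta> n = (C n)\<lparr>carrier := cocycles C \<delta> n\<rparr> Mod coboundaries C \<delta> n"

definition cohomology_class ::
  "(int \<Rightarrow> 'c monoid) \<Rightarrow> (int \<Rightarrow> 'c \<Rightarrow> 'c) \<Rightarrow> int \<Rightarrow> 'c \<Rightarrow> 'c set" where
  "cohomology_class C \<delta> n z = coboundaries C \<delta> n #>\<^bsub>C n\<^esub> z"

text \<open>The degree \<open>n\<close> component \<open>\<Prod>\<^sub>p Hom\<^sub>A(Z\<^sup>p, Z\<^sup>p\<^sup>-\<^sup>n)\<close> of \<open>End\<^sub>A(Z)\<close>, as an additive group.\<close>

definition End_group ::
  "('a, 'r) ring_scheme \<Rightarrow> (int \<Rightarrow> ('a, 'z) module) \<Rightarrow> int \<Rightarrow> (int \<Rightarrow> 'z \<Rightarrow> 'z) monoid" where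
  "End_group A Z n = \<lparr>carrier = {f. \<forall>p. f p \<in> mod_hom A (Z p) (Z (p - n))},
     mult = (\<lambda>f g p. \<lambda>z\<in>carrier (Z p). f p z \<oplus>\<^bsub>Z (p - n)\<^esub> g p z),
     one = (\<lambda>p. \<lambda>z\<in>carrier (Z p). \<zero>\<^bsub>Z (p - n)\<^esub>)\<rparr>"

text \<open>The differential \<open>d f - (-1)\<^sup>n f d\<close> of \<open>f\<close> of degree \<open>n\<close>, where \<open>D p : Z\<^sup>p \<rightarrow> Z\<^sup>p\<^sup>-\<^sup>1\<close>.\<close>

definition End_diff ::
  "(int \<Rightarrow> ('a, 'z) module) \<Rightarrow> (int \<Rightarrow> 'z \<Rightarrow> 'z) \<Rightarrow> int \<Rightarrow>
    (int \<Rightarrow> 'z \<Rightarrow> 'z) \<Rightarrow> (int \<Rightarrow> 'z \<Rightarrow> 'z)" where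
  "End_diff Z D n f = (\<lambda>p. \<lambda>z\<in>carrier (Z p).
     if even n
     then D (p - n) (f p z) \<ominus>\<^bsub>Z (p - (n + 1))\<^esub> f (p - 1) (D p z)
     else D (p - n) (f p z) \<oplus>\<^bsub>Z (p - (n + 1))\<^esub> f (p - 1) (D p z))"

text \<open>The product of \<open>f\<close> and \<open>g\<close>, where \<open>n\<close> is the degree of \<open>g\<close>.\<close>

definition End_mult ::
  "(int \<Rightarrow> ('a, 'z) module) \<Rightarrow> int \<Rightarrow>
    (int \<Rightarrow> 'z \<Rightarrow> 'z) \<Rightarrow> (int \<Rightarrow> 'z \<Rightarrow> 'z) \<Rightarrow> (int \<Rightarrow> 'z \<Rightarrow> 'z)" where
  "End_mult Z n f g = (\<lambda>p. compose (carrier (Z p)) (f (p - n)) (g p))"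

definition End_one :: "(int \<Rightarrow> ('a, 'z) module) \<Rightarrow> (int \<Rightarrow> 'z \<Rightarrow> 'z)" where
  "End_one Z = (\<lambda>p. \<lambda>z\<in>carrier (Z p). z)"

definition Hom_group ::
  "('a, 'r) ring_scheme \<Rightarrow> (int \<Rightarrow> ('a, 'z) module) \<Rightarrow> ('a, 'v) module \<Rightarrow>
    int \<Rightarrow> ('z \<Rightarrow> 'v) monoid" where
  "Hom_group A Z V n = \<lparr>carrier = mod_hom A (Z n) V,
     mult = (\<lambda>\<phi> \<psi>. \<lambda>z\<in>carrier (Z n). \<phi> z \<oplus>\<^bsub>V\<^esub> \<psi> z),
     one = (\<lambda>z\<in>carrier (Z n). \<zero>\<^bsub>V\<^esub>)\<rparr>"

definition Hom_diff ::
  "(int \<Rightarrow> ('a, 'z) module) \<Rightarrow> (int \<Rightarrow> 'z \<Rightarrow> 'z) \<Rightarrow> int \<Rightarrow> ('z \<Rightarrow> 'v) \<Rightarrow> ('z \<Rightarrow> 'v)" where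
  "Hom_diff Z D n \<phi> = compose (carrier (Z (n + 1))) \<phi> (D (n + 1))"


section \<open>The Hecke algebra\<close>

text \<open>In this section \<open>(X, d)\<close> is the chosen resolution of the \<open>B\<close>-module \<open>\<complex>\<close>.\<close>

abbreviation induced ::
  "(complex, 'a) module \<Rightarrow> 'a set \<Rightarrow> (int \<Rightarrow> ('a, 'x) module) \<Rightarrow>
    int \<Rightarrow> ('a, (('a \<times> 'x) \<Rightarrow>\<^sub>0 int) set) module" where
  "induced A B X \<equiv> (\<lambda>p. tensor_module A B (X p))"

abbreviation induced_diff ::
  "(complex, 'a) module \<Rightarrow> 'a set \<Rightarrow> (int \<Rightarrow> ('a, 'x) module) \<Rightarrow> (int \<Rightarrow> 'x \<Rightarrow> 'x) \<Rightarrow>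
    int \<Rightarrow> (('a \<times> 'x) \<Rightarrow>\<^sub>0 int) set \<Rightarrow> (('a \<times> 'x) \<Rightarrow>\<^sub>0 int) set" where
  "induced_diff A B X d \<equiv> (\<lambda>p. tensor_map A B (X p) (X (p - 1)) (d p))"

definition Hk_cocycles where
  "Hk_cocycles A B X d = cocycles (End_group A (induced A B X))
     (End_diff (induced A B X) (induced_diff A B X d))"

definition Hk_class where
  "Hk_class A B X d = cohomology_class (End_group A (induced A B X))
     (End_diff (induced A B X) (induced_diff A B X d))"

definition Hk_group where
  "Hk_group A B X d = cohomology (End_group A (induced A B X))
     (End_diff (induced A B X) (induced_diff A B X d))"

text \<open>The product of a class of degree \<open>m\<close> and a class of degree \<open>n\<close>.\<close>

definition Hk_mult where
  "Hk_mult A B X d m n U W =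
     (\<Union>f\<in>U. \<Union>g\<in>W. Hk_class A B X d (m + n) (End_mult (induced A B X) n f g))"

text \<open>The complex algebra \<open>Hk\<^sup>0(A,B)\<close>.\<close>

definition Hk0 ::
  "(complex, 'a) module \<Rightarrow> 'a set \<Rightarrow> (int \<Rightarrow> ('a, 'x) module) \<Rightarrow> (int \<Rightarrow> 'x \<Rightarrow> 'x) \<Rightarrow>
    (complex, (int \<Rightarrow> (('a \<times> 'x) \<Rightarrow>\<^sub>0 int) set \<Rightarrow> (('a \<times> 'x) \<Rightarrow>\<^sub>0 int) set) set) module" where
  "Hk0 A B X d =
     \<lparr>carrier = carrier (Hk_group A B X d 0),
      mult = Hk_mult A B X d 0 0,
      one = Hk_class A B X d 0 (End_one (induced A B X)),
      ring.zero = \<one>\<^bsub>Hk_group A B X d 0\<^esub>,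
      add = mult (Hk_group A B X d 0),
      smult = (\<lambda>c U. \<Union>f\<in>U. Hk_class A B X d 0
        (\<lambda>p. \<lambda>z\<in>carrier (induced A B X p). (c \<odot>\<^bsub>A\<^esub> \<one>\<^bsub>A\<^esub>) \<odot>\<^bsub>induced A B X p\<^esub> f p z))\<rparr>"

definition opposite :: "('a, 'b) module \<Rightarrow> ('a, 'b) module" where
  "opposite H = H\<lparr>mult := (\<lambda>x y. y \<otimes>\<^bsub>H\<^esub> x)\<rparr>"

text \<open>\<open>H\<^sup>n(V) = Ext\<^sup>n\<^sub>B(\<complex>, V)\<close>, computed by the complex
  \<open>Hom\<^sub>A(A \<otimes>\<^sub>B X, V) = Hom\<^sub>B(X, V)\<close>.\<close>

definition Ext_group where
  "Ext_group A B X d V = cohomology (Hom_group A (induced A B X) V)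
     (Hom_diff (induced A B X) (induced_diff A B X d))"

definition Ext_class where
  "Ext_class A B X d V = cohomology_class (Hom_group A (induced A B X) V)
     (Hom_diff (induced A B X) (induced_diff A B X d))"

text \<open>The right action \<open>[\<phi>] \<cdot> [f] = [\<phi> \<circ> f]\<close> of \<open>Hk\<^sup>n(A,B)\<close> on \<open>H\<^sup>m(V)\<close>, with
  values in \<open>H\<^sup>m\<^sup>+\<^sup>n(V)\<close>.\<close>

definition Ext_act where
  "Ext_act A B X d V m n \<Phi> U = (\<Union>\<phi>\<in>\<Phi>. \<Union>f\<in>U.
     Ext_class A B X d V (m + n) (compose (carrier (induced A B X (m + n))) \<phi> (f (m + n))))"


section \<open>Invariants and Dirac's condition\<close>

definition invariants ::
  "(complex, 'a) module \<Rightarrow> 'a set \<Rightarrow> ('a \<Rightarrow> complex) \<Rightarrow> ('a, 'v) module \<Rightarrow> 'v set" where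
  "invariants A B \<epsilon> V =
     {v \<in> carrier V. \<forall>b\<in>B. b \<odot>\<^bsub>V\<^esub> v = (\<epsilon> b \<odot>\<^bsub>A\<^esub> \<one>\<^bsub>A\<^esub>) \<odot>\<^bsub>V\<^esub> v}"

definition dirac_condition ::
  "(complex, 'a) module \<Rightarrow> 'a set \<Rightarrow> ('a \<Rightarrow> complex) \<Rightarrow> ('a, 'v) module \<Rightarrow> 'a \<Rightarrow> bool" where
  "dirac_condition A B \<epsilon> V a \<longleftrightarrow> (\<forall>b\<in>B. \<forall>v\<in>invariants A B \<epsilon> V.
     (b \<otimes>\<^bsub>A\<^esub> a \<ominus>\<^bsub>A\<^esub> a \<otimes>\<^bsub>A\<^esub> b) \<odot>\<^bsub>V\<^esub> v = \<zero>\<^bsub>V\<^esub>)"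

text \<open>All modules \<open>X p\<close> live in one type, different from that of \<open>B\<close>. So the equality \<open>X\<^sub>0 = B\<close> is
  rendered by an isomorphism \<open>\<beta>\<close> of left \<open>B\<close>-modules from \<open>B\<close> to \<open>X 0\<close>, and the equality
  \<open>A \<otimes>\<^sub>B X\<^sub>0 = A\<close> by the isomorphism \<open>a \<mapsto> a \<otimes> \<beta> 1\<close>.\<close>

definition A_iso ::
  "(complex, 'a) module \<Rightarrow> 'a set \<Rightarrow> (int \<Rightarrow> ('a, 'x) module) \<Rightarrow> ('a \<Rightarrow> 'x) \<Rightarrow>
    'a \<Rightarrow> (('a \<times> 'x) \<Rightarrow>\<^sub>0 int) set" where
  "A_iso A B X \<beta> = (\<lambda>a\<in>carrier A. pure_tensor A B (X 0) a (\<beta> \<one>\<^bsub>A\<^esub>))"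

text \<open>The component \<open>f\<^sup>0\<^sup>,\<^sup>0\<close> as an endomorphism of \<open>A\<close>.\<close>

definition component00 where
  "component00 A B X \<beta> f =
     (\<lambda>a\<in>carrier A. inv_into (carrier A) (A_iso A B X \<beta>) (f 0 (A_iso A B X \<beta> a)))"

text \<open>The cocycle \<open>\<phi> : A = A \<otimes>\<^sub>B X\<^sub>0 \<rightarrow> V\<close>, \<open>\<phi>(x) = x v\<close>.\<close>

definition orbit_cocycle where
  "orbit_cocycle A B X \<beta> V v =
     (\<lambda>z\<in>carrier (induced A B X 0). inv_into (carrier A) (A_iso A B X \<beta>) z \<odot>\<^bsub>V\<^esub> v)"

definition invariant_class where
  "invariant_class A B X d \<beta> V v = Ext_class A B X d V 0 (orbit_cocycle A B X \<beta> V v)"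

text \<open>The action of \<open>Hk\<^sup>0(A,B)\<close> on \<open>H\<^sup>0(V)\<close>, transported to \<open>V\<^sup>B\<close>; a right action of
  \<open>Hk\<^sup>0(A,B)\<close>, hence a left action of the opposite algebra.\<close>

definition Hk0_act where
  "Hk0_act A B X d \<epsilon> \<beta> V U v =
     inv_into (invariants A B \<epsilon> V) (invariant_class A B X d \<beta> V)
       (Ext_act A B X d V 0 0 (invariant_class A B X d \<beta> V v) U)"

end

theory Submission
  imports Defs
begin

text \<open>
  Write \<open>Z\<^sub>p = A \<otimes>\<^sub>B X\<^sub>p\<close>, and let \<open>D\<close> be its differential. Since \<open>X\<^sub>0\<close> is a copy of \<open>B\<close>, the
  \<open>A\<close>-module \<open>Z\<^sub>0\<close> is free on the single generator \<open>1 \<otimes> \<beta> 1\<close>. A homomorphism \<open>\<psi>\<close> from \<open>Z\<^sub>0\<close> to an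
  \<open>A\<close>-module \<open>V\<close> is therefore the same thing as the vector \<open>\<psi> (1 \<otimes> \<beta> 1)\<close>, and by exactness of \<open>X\<close>
  at \<open>X\<^sub>0\<close> the image of \<open>D\<^sub>1\<close> is the left ideal \<open>A \<cdot> ker \<epsilon>\<close> of \<open>A = Z\<^sub>0\<close>. As \<open>B = \<complex> 1 + ker \<epsilon>\<close>, the
  vector is \<open>B\<close>-invariant exactly when \<open>\<psi>\<close> kills this image, that is, when \<open>\<psi>\<close> is a cocycle
  (\<open>invariant_orbit_cocycle\<close>, \<open>cocycle_value_invariant\<close>).

  Now let \<open>v\<close> be invariant with cocycle \<open>\<phi>\<^sub>v\<close>, and let \<open>f\<close> be a cocycle of degree zero. Then
  \<open>\<phi>\<^sub>v f\<^sub>0 D\<^sub>1 = \<phi>\<^sub>v D\<^sub>1 f\<^sub>1 = 0\<close>, so \<open>\<phi>\<^sub>v f\<^sub>0\<close> is again a cocycle. Its value at the generator is \<open>a v\<close>,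
  because \<open>f\<^sub>0\<close> is right multiplication by \<open>a\<close>. Hence \<open>a v\<close> is invariant and \<open>\<phi>\<^sub>v f\<^sub>0 = \<phi>\<^sub>a\<^sub>v\<close>
  (\<open>orbit_compose_cocycle\<close>). Dirac's condition is then the computation
  \<open>b a v = \<epsilon>(b) a v = a \<epsilon>(b) v = a b v\<close> (\<open>dirac_condition_of_invariant\<close>).

  For the action on classes, \<open>Z\<close> vanishes in negative degrees. So there are no nonzero coboundaries in
  degree zero of \<open>Hom\<^sub>A(Z, V)\<close>, and a class there is a single cocycle (\<open>Ext0_class\<close>). A coboundary in degree
  zero of \<open>End\<^sub>A(Z)\<close> has \<open>(0,0)\<close>-component \<open>D\<^sub>1 k\<close>, which \<open>\<phi>\<^sub>v\<close> kills, so all representatives of the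
  Hecke class act alike (\<open>orbit_on_Hk0_class\<close>).

  The technical prerequisite is that \<open>Z\<^sub>p\<close>, built as a quotient of a free abelian group, is an \<open>A\<close>-module,
  functorially in \<open>X\<^sub>p\<close>. Everything of this kind is deduced from one fact: an additive map on the free
  group that is bilinear and balanced on generators is constant on the classes
  (\<open>balanced_hom_respects_class\<close>).
\<close>

section \<open>Homomorphisms of left modules\<close>

lemma abelian_group_homD:
  assumes M: "abelian_group M" and N: "abelian_group N"
    and h: "h \<in> hom (add_monoid M) (add_monoid N)"
  shows "h \<zero>\<^bsub>M\<^esub> = \<zero>\<^bsub>N\<^esub>"
    and "\<lbrakk>x \<in> carrier M; y \<in> carrier M\<rbrakk> \<Longrightarrow> h (x \<ominus>\<^bsub>M\<^esub> y) = h x \<ominus>\<^bsub>N\<^esub> h y"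
proof -
  interpret M: abelian_group M by fact
  interpret N: abelian_group N by fact
  interpret h: group_hom "add_monoid M" "add_monoid N" h
    by (intro group_hom.intro group_hom_axioms.intro h M.add.is_group N.add.is_group)
  show "h \<zero>\<^bsub>M\<^esub> = \<zero>\<^bsub>N\<^esub>" using h.hom_one by simp
  show "h (x \<ominus>\<^bsub>M\<^esub> y) = h x \<ominus>\<^bsub>N\<^esub> h y" if "x \<in> carrier M" "y \<in> carrier M"
    using h.hom_mult[of x "\<ominus>\<^bsub>M\<^esub> y"] h.hom_inv[of y] that by (simp add: a_minus_def a_inv_def)
qed

lemma mod_hom_additive: "h \<in> mod_hom R M N \<Longrightarrow> h \<in> hom (add_monoid M) (add_monoid N)"
  by (auto simp: mod_hom_def hom_def)

lemma mod_homD: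
  assumes "h \<in> mod_hom R M N"
  shows "x \<in> carrier M \<Longrightarrow> h x \<in> carrier N"
    and "\<lbrakk>x \<in> carrier M; y \<in> carrier M\<rbrakk> \<Longrightarrow> h (x \<oplus>\<^bsub>M\<^esub> y) = h x \<oplus>\<^bsub>N\<^esub> h y"
    and "\<lbrakk>r \<in> carrier R; x \<in> carrier M\<rbrakk> \<Longrightarrow> h (r \<odot>\<^bsub>M\<^esub> x) = r \<odot>\<^bsub>N\<^esub> h x"
  using assms by (auto simp: mod_hom_def)

lemma mod_hom_extensional: "h \<in> mod_hom R M N \<Longrightarrow> h \<in> extensional (carrier M)"
  by (auto simp: mod_hom_def PiE_def)

lemma mod_hom_compose:
  assumes "g \<in> mod_hom R M N" "h \<in> mod_hom R L M" "left_module R L"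
  shows "compose (carrier L) g h \<in> mod_hom R L N"
proof -
  interpret L: left_module R L by fact
  show ?thesis
    using mod_homD[OF assms(1)] mod_homD[OF assms(2)]
    by (simp add: mod_hom_def PiE_iff compose_def)
qed

lemma mod_hom_zero:
  assumes "left_module R M" "left_module R N" "h \<in> mod_hom R M N"
  shows "h \<zero>\<^bsub>M\<^esub> = \<zero>\<^bsub>N\<^esub>"
  using abelian_group_homD(1)[OF _ _ mod_hom_additive[OF assms(3)]] assms(1,2)
  by (simp add: left_module_def)

lemma zero_mod_hom:
  assumes "left_module R M" "left_module R N"
  shows "(\<lambda>x\<in>carrier M. \<zero>\<^bsub>N\<^esub>) \<in> mod_hom R M N"
proof -
  interpret M: left_module R M by fact
  interpret N: left_module R N by fact
  show ?thesis by (simp add: mod_hom_def)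
qed

section \<open>The tensor product over a subring\<close>

lemma free_Abelian_group_add_closed:
  "\<lbrakk>u \<in> carrier (free_Abelian_group S); w \<in> carrier (free_Abelian_group S)\<rbrakk> \<Longrightarrow>
    u + w \<in> carrier (free_Abelian_group S)"
  using keys_add[of u w] by auto

lemma free_Abelian_group_diff_closed:
  "\<lbrakk>u \<in> carrier (free_Abelian_group S); w \<in> carrier (free_Abelian_group S)\<rbrakk> \<Longrightarrow>
    u - w \<in> carrier (free_Abelian_group S)"
  using keys_diff[of u w] by auto

locale tensor_product = A?: ring A + X: left_module "A\<lparr>carrier := B\<rparr>" X
  for A :: "('a, 'r) ring_scheme" (structure) and B :: "'a set" and X :: "('a, 'x) module" +
  assumes subset: "B \<subseteq> carrier A"
begin

abbreviation Z where "Z \<equiv> tensor_module A B X"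
abbreviation cls where "cls \<equiv> tensor_class A B X"
abbreviation pure where "pure \<equiv> pure_tensor A B X"
abbreviation F where "F \<equiv> tensor_free A X"

lemma act_closed: "b \<in> B \<Longrightarrow> x \<in> carrier X \<Longrightarrow> b \<odot>\<^bsub>X\<^esub> x \<in> carrier X"
  by simp

lemma tensor_relations_normal: "tensor_relations A B X \<lhd> F"
proof -
  interpret F: comm_group F by (rule abelian_free_Abelian_group)
  show ?thesis
    unfolding tensor_relations_def
    by (intro F.subgroup_imp_normal F.generate_is_subgroup)
      (use subset in \<open>auto dest!: keys_diff[THEN subsetD] keys_add[THEN subsetD]
        simp: act_closed subsetD\<close>)
qed

text \<open>The universal property of the tensor product, stated for maps on the free abelian group
  because the operations on the tensor product are defined by formulas on representatives. The kernel
  of \<open>h\<close> is a subgroup containing the generating relations, hence all of them.\<close>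

lemma balanced_hom_respects_class:
  assumes G: "group G" and h: "h \<in> hom F G"
    and left: "\<And>a a' x. \<lbrakk>a \<in> carrier A; a' \<in> carrier A; x \<in> carrier X\<rbrakk> \<Longrightarrow>
      h (frag_of (a \<oplus> a', x)) = h (frag_of (a, x)) \<otimes>\<^bsub>G\<^esub> h (frag_of (a', x))"
    and right: "\<And>a x x'. \<lbrakk>a \<in> carrier A; x \<in> carrier X; x' \<in> carrier X\<rbrakk> \<Longrightarrow>
      h (frag_of (a, x \<oplus>\<^bsub>X\<^esub> x')) = h (frag_of (a, x)) \<otimes>\<^bsub>G\<^esub> h (frag_of (a, x'))"
    and balanced: "\<And>a b x. \<lbrakk>a \<in> carrier A; b \<in> B; x \<in> carrier X\<rbrakk> \<Longrightarrow>
      h (frag_of (a \<otimes> b, x)) = h (frag_of (a, b \<odot>\<^bsub>X\<^esub> x))"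
    and u: "u \<in> carrier F" and w: "w \<in> carrier F" and eq: "cls u = cls w"
  shows "h u = h w"
proof -
  interpret F: comm_group F by (rule abelian_free_Abelian_group)
  interpret h: group_hom F G h
    using G h by (intro group_hom.intro group_hom_axioms.intro) auto
  have diff: "v - v' \<in> kernel F G h" if v: "v \<in> carrier F" "v' \<in> carrier F" "h v = h v'" for v v'
  proof -
    have "h (v - v') \<otimes>\<^bsub>G\<^esub> h v' = \<one>\<^bsub>G\<^esub> \<otimes>\<^bsub>G\<^esub> h v'"
      using h.hom_mult[OF free_Abelian_group_diff_closed[OF v(1,2)] v(2)] h.hom_closed[OF v(2)] v(3)
      by simp
    then show ?thesis
      using h.H.right_cancel[of "h v'" "h (v - v')" "\<one>\<^bsub>G\<^esub>"] h.hom_closed v(1,2)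
        free_Abelian_group_diff_closed[OF v(1,2)]
      by (simp add: kernel_def del: carrier_free_Abelian_group_iff)
  qed
  have plus: "h (v + v') = h v \<otimes>\<^bsub>G\<^esub> h v'" "v + v' \<in> carrier F"
    if "v \<in> carrier F" "v' \<in> carrier F" for v v'
    using h.hom_mult[OF that] free_Abelian_group_add_closed[OF that] by simp_all
  have kernel: "subgroup (kernel F G h) F" by (rule h.subgroup_kernel)
  have "tensor_relations A B X \<subseteq> kernel F G h"
    unfolding tensor_relations_def
    by (rule F.generate_subgroup_incl[OF _ kernel], safe; rule diff)
      (use subset in \<open>auto simp: plus left right balanced act_closed subsetD
        simp del: carrier_free_Abelian_group_iff simp add: frag_of_in_free_Abelian_group\<close>)
  moreover have "w \<in> cls u"
    using F.rcos_self[OF w normal_imp_subgroup[OF tensor_relations_normal]] eq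
    by (simp add: tensor_class_def)
  then obtain r where r: "r \<in> tensor_relations A B X" "w = r \<otimes>\<^bsub>F\<^esub> u"
    by (auto simp: tensor_class_def r_coset_def)
  ultimately have "r \<in> kernel F G h" by auto
  then show ?thesis using r(2) u h.hom_mult[of r u] h.hom_closed[OF u] by (auto simp: kernel_def)
qed

lemma class_eq: "u \<in> carrier F \<Longrightarrow> w \<in> cls u \<Longrightarrow> w \<in> carrier F \<and> cls w = cls u"
proof -
  assume u: "u \<in> carrier F" and w: "w \<in> cls u"
  interpret F: comm_group F by (rule abelian_free_Abelian_group)
  have sub: "subgroup (tensor_relations A B X) F"
    by (rule normal_imp_subgroup[OF tensor_relations_normal])
  show ?thesis
    using F.repr_independence[OF _ u sub, of w] w
      F.r_coset_subset_G[OF subgroup.subset[OF sub] u]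
    unfolding tensor_class_def by blast
qed

lemma class_self: "u \<in> carrier F \<Longrightarrow> u \<in> cls u"
  unfolding tensor_class_def
  by (rule group.rcos_self[OF group_free_Abelian_group _ normal_imp_subgroup[OF tensor_relations_normal]])

lemma carrier_tensor: "carrier Z = cls ` carrier F"
  by (auto simp: tensor_module_def Let_def FactGroup_def RCOSETS_def tensor_class_def)

lemma class_closed: "u \<in> carrier F \<Longrightarrow> cls u \<in> carrier Z"
  unfolding carrier_tensor by (rule imageI)

lemma tensor_add_class:
  assumes "u \<in> carrier F" "w \<in> carrier F"
  shows "cls u \<oplus>\<^bsub>Z\<^esub> cls w = cls (u + w)"
  using normal.rcos_sum[OF tensor_relations_normal assms]
  by (simp add: tensor_module_def Let_def tensor_class_def)

lemma abelian_group_tensor: "abelian_group Z"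
proof -
  interpret Q: comm_group "F Mod tensor_relations A B X"
    by (rule comm_group.abelian_FactGroup[OF abelian_free_Abelian_group
          normal_imp_subgroup[OF tensor_relations_normal]])
  have Z: "carrier Z = carrier (F Mod tensor_relations A B X)"
    "add Z = mult (F Mod tensor_relations A B X)" "\<zero>\<^bsub>Z\<^esub> = \<one>\<^bsub>F Mod tensor_relations A B X\<^esub>"
    by (simp_all add: tensor_module_def Let_def)
  show ?thesis
    by (rule abelian_groupI; unfold Z)
      (rule Q.m_closed Q.one_closed Q.m_assoc Q.m_comm Q.l_one Q.l_inv_ex; assumption)+
qed

sublocale tensor: abelian_group Z
  by (rule abelian_group_tensor)

lemma class_hom: "cls \<in> hom F (add_monoid Z)"
  by (auto simp: hom_def class_closed tensor_add_class simp del: carrier_free_Abelian_group_iff)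

lemma class_diff:
  assumes "u \<in> carrier F" "w \<in> carrier F"
  shows "cls (u - w) = cls u \<ominus>\<^bsub>Z\<^esub> cls w"
proof -
  interpret F: comm_group F by (rule abelian_free_Abelian_group)
  interpret h: group_hom F "add_monoid Z" cls
    by (intro group_hom.intro group_hom_axioms.intro class_hom group_free_Abelian_group
        tensor.add.is_group)
  have "- w \<in> carrier F" using F.inv_closed[OF assms(2)] assms(2) by simp
  have "cls (- w) = \<ominus>\<^bsub>Z\<^esub> cls w"
    using h.hom_inv[OF assms(2)] assms(2) by (simp add: a_inv_def)
  then show ?thesis
    using tensor_add_class[OF assms(1) \<open>- w \<in> carrier F\<close>] by (simp add: a_minus_def)
qed

lemma pure_closed [simp]: "a \<in> carrier A \<Longrightarrow> x \<in> carrier X \<Longrightarrow> pure a x \<in> carrier Z"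
  by (simp add: pure_tensor_def class_closed)

text \<open>The tensor product is generated by the pure tensors. Closure under differences also yields the
  zero tensor, as \<open>0 \<otimes> 0 - 0 \<otimes> 0\<close>.\<close>

lemma tensor_induct [consumes 1, case_names pure diff]:
  assumes z: "z \<in> carrier Z"
    and pure: "\<And>a x. a \<in> carrier A \<Longrightarrow> x \<in> carrier X \<Longrightarrow> P (pure a x)"
    and diff: "\<And>y z. y \<in> carrier Z \<Longrightarrow> z \<in> carrier Z \<Longrightarrow> P y \<Longrightarrow> P z \<Longrightarrow> P (y \<ominus>\<^bsub>Z\<^esub> z)"
  shows "P z"
proof -
  obtain u where u: "u \<in> carrier F" "z = cls u" using z carrier_tensor by auto
  have "Poly_Mapping.keys u \<subseteq> carrier A \<times> carrier X" using u by simp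
  then have "P (cls u)"
  proof (induction u rule: free_Abelian_group_induct[consumes 1, case_names zero diff one])
    case zero
    have "P (pure \<zero> \<zero>\<^bsub>X\<^esub> \<ominus>\<^bsub>Z\<^esub> pure \<zero> \<zero>\<^bsub>X\<^esub>)" by (intro diff pure) auto
    moreover have "cls 0 = \<zero>\<^bsub>Z\<^esub>"
      using class_diff[of 0 0] class_closed[of 0] by (simp add: a_minus_def tensor.r_neg)
    ultimately show ?case by (simp add: a_minus_def tensor.r_neg)
  next
    case (diff u w)
    then show ?case using class_diff[of u w] class_closed assms(3) by simp
  next
    case (one p)
    then show ?case using pure by (cases p) (simp add: pure_tensor_def)
  qed
  then show ?thesis using u by simp
qed

lemma class_eqI:
  assumes "v \<in> carrier F" "w \<in> carrier F" "v - w \<in> tensor_relations A B X"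
  shows "cls v = cls w"
proof -
  have "v \<in> cls w"
    unfolding tensor_class_def r_coset_def using assms(3) by (auto intro!: bexI[of _ "v - w"])
  then show ?thesis using class_eq[OF assms(2)] by blast
qed

lemma pure_add_left:
  assumes "a \<in> carrier A" "a' \<in> carrier A" "x \<in> carrier X"
  shows "pure (a \<oplus> a') x = pure a x \<oplus>\<^bsub>Z\<^esub> pure a' x"
proof -
  have "frag_of (a, x) + frag_of (a', x) \<in> carrier F"
    by (rule free_Abelian_group_add_closed) (use assms in simp_all)
  moreover have "frag_of (a \<oplus> a', x) - (frag_of (a, x) + frag_of (a', x)) \<in> tensor_relations A B X"
    unfolding tensor_relations_def by (rule generate.incl) (use assms in blast)
  ultimately show ?thesis
    using assms class_eqI[of "frag_of (a \<oplus> a', x)"]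
    by (simp add: pure_tensor_def tensor_add_class)
qed

lemma pure_add_right:
  assumes "a \<in> carrier A" "x \<in> carrier X" "x' \<in> carrier X"
  shows "pure a (x \<oplus>\<^bsub>X\<^esub> x') = pure a x \<oplus>\<^bsub>Z\<^esub> pure a x'"
proof -
  have "frag_of (a, x) + frag_of (a, x') \<in> carrier F"
    by (rule free_Abelian_group_add_closed) (use assms in simp_all)
  moreover have "frag_of (a, x \<oplus>\<^bsub>X\<^esub> x') - (frag_of (a, x) + frag_of (a, x')) \<in> tensor_relations A B X"
    unfolding tensor_relations_def by (rule generate.incl) (use assms in blast)
  ultimately show ?thesis
    using assms class_eqI[of "frag_of (a, x \<oplus>\<^bsub>X\<^esub> x')"]
    by (simp add: pure_tensor_def tensor_add_class)
qed

lemma pure_balanced: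
  assumes "a \<in> carrier A" "b \<in> B" "x \<in> carrier X"
  shows "pure (a \<otimes> b) x = pure a (b \<odot>\<^bsub>X\<^esub> x)"
proof -
  have "frag_of (a \<otimes> b, x) - frag_of (a, b \<odot>\<^bsub>X\<^esub> x) \<in> tensor_relations A B X"
    unfolding tensor_relations_def by (rule generate.incl) (use assms in blast)
  then show ?thesis
    using assms class_eqI[of "frag_of (a \<otimes> b, x)" "frag_of (a, b \<odot>\<^bsub>X\<^esub> x)"]
    by (simp add: pure_tensor_def act_closed subsetD[OF subset])
qed

end

text \<open>The map \<open>p \<otimes> g\<close> for a right \<open>B\<close>-linear endomorphism \<open>p\<close> of \<open>A\<close> and a \<open>B\<close>-linear map \<open>g\<close>. With \<open>p\<close>
  the left multiplication by an element of \<open>A\<close> and \<open>g\<close> the identity it is the scalar multiplication of the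
  tensor product; with \<open>p\<close> the identity it is the functorial map \<open>1 \<otimes> g\<close>. Both are thus seen to be well
  defined at once.\<close>

locale tensor_product_map = X: tensor_product A B X + Y: tensor_product A B Y
  for A :: "('a, 'r) ring_scheme" (structure) and B :: "'a set"
    and X :: "('a, 'x) module" and Y :: "('a, 'y) module" +
  fixes p :: "'a \<Rightarrow> 'a" and g :: "'x \<Rightarrow> 'y"
  assumes p_closed: "a \<in> carrier A \<Longrightarrow> p a \<in> carrier A"
    and p_add: "\<lbrakk>a \<in> carrier A; a' \<in> carrier A\<rbrakk> \<Longrightarrow> p (a \<oplus> a') = p a \<oplus> p a'"
    and p_mult: "\<lbrakk>a \<in> carrier A; b \<in> B\<rbrakk> \<Longrightarrow> p (a \<otimes> b) = p a \<otimes> b"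
    and g_closed: "x \<in> carrier X \<Longrightarrow> g x \<in> carrier Y"
    and g_add: "\<lbrakk>x \<in> carrier X; x' \<in> carrier X\<rbrakk> \<Longrightarrow> g (x \<oplus>\<^bsub>X\<^esub> x') = g x \<oplus>\<^bsub>Y\<^esub> g x'"
    and g_smult: "\<lbrakk>b \<in> B; x \<in> carrier X\<rbrakk> \<Longrightarrow> g (b \<odot>\<^bsub>X\<^esub> x) = b \<odot>\<^bsub>Y\<^esub> g x"
begin

definition frag_map where "frag_map = frag_extend (\<lambda>(a, x). frag_of (p a, g x))"

lemma frag_map_hom: "frag_map \<in> hom X.F Y.F"
proof -
  have "Poly_Mapping.keys (frag_map u) \<subseteq> carrier A \<times> carrier Y"
    if "Poly_Mapping.keys u \<subseteq> carrier A \<times> carrier X" for u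
    unfolding frag_map_def
    by (rule order_trans[OF keys_frag_extend]) (use that p_closed g_closed in auto)
  then show ?thesis by (auto simp: hom_def frag_map_def frag_extend_add)
qed

lemma frag_map_respects_class:
  assumes "u \<in> carrier X.F" "w \<in> carrier X.F" "X.cls u = X.cls w"
  shows "Y.cls (frag_map u) = Y.cls (frag_map w)"
proof -
  have hom: "(\<lambda>u. Y.cls (frag_map u)) \<in> hom X.F (add_monoid Y.Z)"
    using hom_compose[OF frag_map_hom Y.class_hom] by (simp add: comp_def)
  have of: "Y.cls (frag_map (frag_of (a, x))) = Y.pure (p a) (g x)" for a x
    by (simp add: frag_map_def pure_tensor_def)
  show ?thesis
    by (rule X.balanced_hom_respects_class[OF Y.tensor.add.is_group hom _ _ _ assms])
      (use X.act_closed in \<open>simp_all add: of p_closed p_add p_mult g_closed g_add g_smult Y.pure_add_left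
        Y.pure_add_right Y.pure_balanced\<close>)
qed

definition induced_map where "induced_map U = (\<Union>u\<in>U. Y.cls (frag_map u))"

lemma induced_map_class:
  assumes "u \<in> carrier X.F" shows "induced_map (X.cls u) = Y.cls (frag_map u)"
  unfolding induced_map_def
proof (rule SUP_eq_const)
  show "X.cls u \<noteq> {}" using X.class_self[OF assms] by blast
  show "Y.cls (frag_map w) = Y.cls (frag_map u)" if "w \<in> X.cls u" for w
    using X.class_eq[OF assms that] by (intro frag_map_respects_class) (use assms in auto)
qed

lemma induced_map_hom: "induced_map \<in> hom (add_monoid X.Z) (add_monoid Y.Z)"
proof (rule homI, simp_all only: partial_object.simps monoid.simps)
  have cl: "frag_map u \<in> carrier Y.F" if "u \<in> carrier X.F" for u
    using frag_map_hom that by (rule hom_in_carrier)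
  fix z assume "z \<in> carrier X.Z"
  then obtain u where u: "u \<in> carrier X.F" "z = X.cls u" by (auto simp only: X.carrier_tensor)
  then show "induced_map z \<in> carrier Y.Z"
    by (simp only: induced_map_class Y.class_closed cl)
  fix z' assume "z' \<in> carrier X.Z"
  then obtain u' where u': "u' \<in> carrier X.F" "z' = X.cls u'" by (auto simp only: X.carrier_tensor)
  have "frag_map (u + u') = frag_map u + frag_map u'" by (simp add: frag_map_def frag_extend_add)
  then show "induced_map (z \<oplus>\<^bsub>X.Z\<^esub> z') = induced_map z \<oplus>\<^bsub>Y.Z\<^esub> induced_map z'"
    using u u' by (simp only: X.tensor_add_class induced_map_class Y.tensor_add_class cl
        free_Abelian_group_add_closed)
qed

lemma induced_map_pure:
  "\<lbrakk>a \<in> carrier A; x \<in> carrier X\<rbrakk> \<Longrightarrow> induced_map (X.pure a x) = Y.pure (p a) (g x)"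
  using induced_map_class[of "frag_of (a, x)"] by (simp add: pure_tensor_def frag_map_def)

end

context tensor_product
begin

lemma left_mult_map:
  assumes "r \<in> carrier A" shows "tensor_product_map A B X X (\<lambda>a. r \<otimes> a) (\<lambda>x. x)"
  by unfold_locales (use assms subset act_closed in \<open>auto simp: r_distr m_assoc subsetD\<close>)

lemma smult_eq_induced_map:
  assumes "r \<in> carrier A"
  shows "r \<odot>\<^bsub>Z\<^esub> z = tensor_product_map.induced_map A B X (\<lambda>a. r \<otimes> a) (\<lambda>x. x) z"
  by (simp add: tensor_module_def Let_def
      tensor_product_map.induced_map_def[OF left_mult_map[OF assms]]
      tensor_product_map.frag_map_def[OF left_mult_map[OF assms]])

lemma smult_pure:
  assumes "r \<in> carrier A" "a \<in> carrier A" "x \<in> carrier X"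
  shows "r \<odot>\<^bsub>Z\<^esub> pure a x = pure (r \<otimes> a) x"
  unfolding smult_eq_induced_map[OF assms(1)]
  by (rule tensor_product_map.induced_map_pure[OF left_mult_map[OF assms(1)] assms(2,3)])

lemma smult_hom:
  assumes "r \<in> carrier A" shows "(\<lambda>z. r \<odot>\<^bsub>Z\<^esub> z) \<in> hom (add_monoid Z) (add_monoid Z)"
  unfolding smult_eq_induced_map[OF assms]
  using tensor_product_map.induced_map_hom[OF left_mult_map[OF assms]] by simp

lemma left_module_tensor: "left_module A Z"
proof -
  note hdiff = abelian_group_homD(2)[OF abelian_group_tensor abelian_group_tensor smult_hom]
  have closed: "r \<odot>\<^bsub>Z\<^esub> z \<in> carrier Z" if "r \<in> carrier A" "z \<in> carrier Z" for r z
    using hom_in_carrier[OF smult_hom[OF that(1)]] that(2) by simp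
  show ?thesis
  proof unfold_locales
    fix r s z z' assume r: "r \<in> carrier A" and s: "s \<in> carrier A" and z: "z \<in> carrier Z"
    show "r \<odot>\<^bsub>Z\<^esub> z \<in> carrier Z" using closed r z by simp
    show "r \<odot>\<^bsub>Z\<^esub> (z \<oplus>\<^bsub>Z\<^esub> z') = r \<odot>\<^bsub>Z\<^esub> z \<oplus>\<^bsub>Z\<^esub> r \<odot>\<^bsub>Z\<^esub> z'" if "z' \<in> carrier Z"
      using hom_mult[OF smult_hom[OF r], of z z'] z that by simp
    show "(r \<oplus> s) \<odot>\<^bsub>Z\<^esub> z = r \<odot>\<^bsub>Z\<^esub> z \<oplus>\<^bsub>Z\<^esub> s \<odot>\<^bsub>Z\<^esub> z"
      using z
    proof (induction z rule: tensor_induct)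
      case (pure a x)
      then show ?case using r s by (simp add: smult_pure l_distr pure_add_left)
    next
      case (diff y z)
      then show ?case
        using r s by (simp add: hdiff closed)
          (simp add: closed a_minus_def tensor.minus_add tensor.a_ac)
    qed
    show "(r \<otimes> s) \<odot>\<^bsub>Z\<^esub> z = r \<odot>\<^bsub>Z\<^esub> (s \<odot>\<^bsub>Z\<^esub> z)"
      using z
    proof (induction z rule: tensor_induct)
      case (pure a x)
      then show ?case using r s by (simp add: smult_pure m_assoc)
    next
      case (diff y z)
      then show ?case using r s by (simp add: hdiff closed)
    qed
  next
    show "\<one> \<odot>\<^bsub>Z\<^esub> z = z" if "z \<in> carrier Z" for z
      using that
    proof (induction z rule: tensor_induct)
      case (pure a x)
      then show ?case by (simp add: smult_pure)
    next
      case (diff y z)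
      then show ?case by (simp add: hdiff)
    qed
  qed
qed

sublocale tensor: left_module A Z
  by (rule left_module_tensor)

end

lemma tensor_map_pure_and_hom:
  fixes A :: "('a, 'r) ring_scheme" (structure)
  assumes X: "tensor_product A B X" and Y: "tensor_product A B Y"
    and g: "g \<in> mod_hom (A\<lparr>carrier := B\<rparr>) X Y"
  shows tensor_map_pure: "\<lbrakk>a \<in> carrier A; x \<in> carrier X\<rbrakk> \<Longrightarrow>
      tensor_map A B X Y g (pure_tensor A B X a x) = pure_tensor A B Y a (g x)"
    and tensor_map_hom: "tensor_map A B X Y g \<in> mod_hom A (tensor_module A B X) (tensor_module A B Y)"
proof -
  interpret X: tensor_product A B X by fact
  interpret Y: tensor_product A B Y by fact
  interpret tensor_product_map A B X Y "\<lambda>a. a" g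
    by unfold_locales (use g in \<open>auto simp: mod_hom_def\<close>)
  have eq: "tensor_map A B X Y g z = induced_map z" if "z \<in> carrier X.Z" for z
    using that by (simp add: tensor_map_def induced_map_def frag_map_def)
  show pure: "tensor_map A B X Y g (X.pure a x) = Y.pure a (g x)"
    if "a \<in> carrier A" "x \<in> carrier X" for a x
    using that by (simp add: eq induced_map_pure)
  note hom = hom_in_carrier[OF induced_map_hom, simplified] hom_mult[OF induced_map_hom, simplified]
  have smult: "induced_map (r \<odot>\<^bsub>X.Z\<^esub> z) = r \<odot>\<^bsub>Y.Z\<^esub> induced_map z"
    if r: "r \<in> carrier A" and z: "z \<in> carrier X.Z" for r z
    using z
  proof (induction z rule: X.tensor_induct)
    case (pure a x)
    then show ?case using r by (simp add: X.smult_pure Y.smult_pure induced_map_pure g_closed)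
  next
    case (diff y z)
    then show ?case
      using r by (simp add: hom abelian_group_homD(2)[OF X.abelian_group_tensor
          X.abelian_group_tensor X.smult_hom] abelian_group_homD(2)[OF Y.abelian_group_tensor
          Y.abelian_group_tensor Y.smult_hom] abelian_group_homD(2)[OF X.abelian_group_tensor
          Y.abelian_group_tensor induced_map_hom])
  qed
  have "tensor_map A B X Y g \<in> extensional (carrier X.Z)" by (simp add: tensor_map_def)
  then show "tensor_map A B X Y g \<in> mod_hom A X.Z Y.Z"
    by (simp add: mod_hom_def PiE_iff eq hom smult)
qed

context tensor_product
begin

text \<open>\<open>A \<otimes>\<^sub>B B = A\<close>. Surjectivity is the relation \<open>a \<otimes> b = a b \<otimes> 1\<close>. For injectivity the inverse
  \<open>a \<otimes> x \<mapsto> a \<cdot> \<beta>\<^sup>-\<^sup>1 x\<close> has to exist on the quotient, which the universal property provides.\<close>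

lemma tensor_free_rank_one:
  assumes B: "subring B A"
    and \<beta>: "\<beta> \<in> mod_iso (A\<lparr>carrier := B\<rparr>) (regular_module (A\<lparr>carrier := B\<rparr>)) X"
  shows "restrict (\<lambda>a. pure a (\<beta> \<one>)) (carrier A) \<in> mod_iso A (regular_module A) Z"
proof -
  note B_closed = subringE[OF B]
  have \<beta>_closed: "\<beta> b \<in> carrier X" if "b \<in> B" for b
    using \<beta> that by (auto simp: mod_iso_def mod_hom_def regular_module_def)
  have \<beta>_add: "\<beta> (b \<oplus> b') = \<beta> b \<oplus>\<^bsub>X\<^esub> \<beta> b'" if "b \<in> B" "b' \<in> B" for b b'
    using \<beta> that by (auto simp: mod_iso_def mod_hom_def regular_module_def)
  have \<beta>_mult: "\<beta> (b \<otimes> b') = b \<odot>\<^bsub>X\<^esub> \<beta> b'" if "b \<in> B" "b' \<in> B" for b b'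
    using \<beta> that by (auto simp: mod_iso_def mod_hom_def regular_module_def)
  have bij: "bij_betw \<beta> B (carrier X)"
    using \<beta> by (simp add: mod_iso_def regular_module_def)
  have surj: "\<exists>b\<in>B. x = \<beta> b" if "x \<in> carrier X" for x
    using bij that by (auto simp: bij_betw_def)
  let ?\<iota> = "\<lambda>a. pure a (\<beta> \<one>)"
  have \<iota>_hom: "?\<iota> \<in> hom (add_monoid A) (add_monoid Z)"
    by (auto simp: hom_def \<beta>_closed B_closed pure_add_left)
  have pure_\<iota>: "pure a (\<beta> b) = ?\<iota> (a \<otimes> b)" if "a \<in> carrier A" "b \<in> B" for a b
    using pure_balanced[OF that, of "\<beta> \<one>"] \<beta>_mult[OF that(2), of \<one>] \<beta>_closed[of \<one>] B_closed that
    by (auto simp: subsetD)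
  have "z \<in> ?\<iota> ` carrier A" if "z \<in> carrier Z" for z
    using that
  proof (induction z rule: tensor_induct)
    case (pure a x)
    then obtain b where "b \<in> B" "x = \<beta> b" using surj by blast
    then show ?case using pure_\<iota>[of a b] pure subset by auto
  next
    case (diff y z)
    then obtain a a' where "a \<in> carrier A" "a' \<in> carrier A" "y = ?\<iota> a" "z = ?\<iota> a'" by blast
    then show ?case
      using abelian_group_homD(2)[OF is_abelian_group abelian_group_tensor \<iota>_hom, of a a']
        minus_closed[of a a'] by (metis imageI)
  qed
  then have image: "?\<iota> ` carrier A = carrier Z" using \<beta>_closed B_closed by auto
  have inj: "inj_on ?\<iota> (carrier A)"
  proof
    let ?\<gamma> = "inv_into B \<beta>"
    have \<gamma>\<beta>: "?\<gamma> (\<beta> b) = b" if "b \<in> B" for b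
      using bij_betw_inv_into_left[OF bij that] .
    have \<gamma>_closed: "?\<gamma> x \<in> B" if "x \<in> carrier X" for x
      using surj[OF that] \<gamma>\<beta> by auto
    have \<gamma>_carrier: "?\<gamma> x \<in> carrier A" if "x \<in> carrier X" for x
      using \<gamma>_closed[OF that] subset by auto
    have \<gamma>_add: "?\<gamma> (x \<oplus>\<^bsub>X\<^esub> x') = ?\<gamma> x \<oplus> ?\<gamma> x'" if "x \<in> carrier X" "x' \<in> carrier X" for x x'
      using surj[OF that(1)] surj[OF that(2)] B_closed(7) by (auto simp: \<gamma>\<beta> simp flip: \<beta>_add)
    have \<gamma>_mult: "?\<gamma> (b \<odot>\<^bsub>X\<^esub> x) = b \<otimes> ?\<gamma> x" if "b \<in> B" "x \<in> carrier X" for b x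
      using surj[OF that(2)] that(1) B_closed(6) by (auto simp: \<gamma>\<beta> simp flip: \<beta>_mult)
    have "(\<lambda>(a, x). a \<otimes> ?\<gamma> x) ` (carrier A \<times> carrier X) \<subseteq> carrier (add_monoid A)"
      using \<gamma>_carrier by auto
    from comm_group.free_Abelian_group_universal[OF a_comm_group this]
    obtain h where h: "h \<in> hom F (add_monoid A)"
      and h_of: "\<And>p. p \<in> carrier A \<times> carrier X \<Longrightarrow> h (frag_of p) = (case p of (a, x) \<Rightarrow> a \<otimes> ?\<gamma> x)"
      by blast
    fix a a' assume a: "a \<in> carrier A" "a' \<in> carrier A" and eq: "?\<iota> a = ?\<iota> a'"
    have one: "\<beta> \<one> \<in> carrier X" using \<beta>_closed B_closed by blast
    have "h (frag_of (a, \<beta> \<one>)) = h (frag_of (a', \<beta> \<one>))"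
      by (rule balanced_hom_respects_class[OF add.is_group h])
        (use a one eq subset in \<open>simp_all add: h_of l_distr r_distr m_assoc \<gamma>_carrier \<gamma>_add
          \<gamma>_mult act_closed pure_tensor_def subsetD\<close>)
    then show "a = a'" using a one B_closed(3) by (simp add: h_of \<gamma>\<beta>)
  qed
  show ?thesis
    using image inj hom_mult[OF \<iota>_hom] smult_pure \<beta>_closed[OF B_closed(3)]
    by (auto simp: mod_iso_def mod_hom_def regular_module_def bij_betw_def inj_on_def)
qed

end

section \<open>The complex induced from a resolution of the character\<close>

locale dirac_reduction =
  fixes A :: "(complex, 'a) module" (structure)
    and B :: "'a set"
    and \<epsilon> :: "'a \<Rightarrow> complex"
    and X :: "int \<Rightarrow> ('a, 'x) module"
    and d :: "int \<Rightarrow> 'x \<Rightarrow> 'x"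
    and aug :: "'x \<Rightarrow> complex"
    and \<beta> :: "'a \<Rightarrow> 'x"
  assumes algebra: "complex_algebra A"
    and subalgebra: "complex_subalgebra B A"
    and character: "character A B \<epsilon>"
    and resolution: "projective_resolution (A\<lparr>carrier := B\<rparr>) (character_module \<epsilon>) X d aug"
    and \<beta>: "\<beta> \<in> mod_iso (A\<lparr>carrier := B\<rparr>) (regular_module (A\<lparr>carrier := B\<rparr>)) (X 0)"
    and aug_\<beta>: "b \<in> B \<Longrightarrow> aug (\<beta> b) = \<epsilon> b"
begin

sublocale ring A
  using algebra by (simp add: associative_algebra_def)

lemma subring: "subring B A"
  using subalgebra by (simp add: complex_subalgebra_def)

lemmas B_closed = subringE[OF subring]

lemma left_module_X: "left_module (A\<lparr>carrier := B\<rparr>) (X p)"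
  using projective_resolution.projective[OF resolution] by (simp add: projective_module_def)

sublocale T: tensor_product A B "X p" for p :: int
  by (intro tensor_product.intro tensor_product_axioms.intro left_module_X B_closed(1) ring_axioms)

abbreviation Z where "Z \<equiv> induced A B X"
abbreviation D where "D \<equiv> induced_diff A B X d"
abbreviation \<iota> where "\<iota> \<equiv> A_iso A B X \<beta>"
abbreviation \<kappa> where "\<kappa> \<equiv> inv_into (carrier A) \<iota>"

lemma D_hom: "D p \<in> mod_hom A (Z p) (Z (p - 1))"
  by (rule tensor_map_hom[OF T.tensor_product_axioms T.tensor_product_axioms
        projective_resolution.differential[OF resolution]])

lemma D_pure:
  "\<lbrakk>a \<in> carrier A; x \<in> carrier (X p)\<rbrakk> \<Longrightarrow> D p (T.pure p a x) = T.pure (p - 1) a (d p x)"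
  by (rule tensor_map_pure[OF T.tensor_product_axioms T.tensor_product_axioms
        projective_resolution.differential[OF resolution]])

lemma Z_negative:
  assumes "p < 0" "z \<in> carrier (Z p)" shows "z = \<zero>\<^bsub>Z p\<^esub>"
  using assms(2)
proof (induction z rule: T.tensor_induct)
  case (pure a x)
  then have x: "x = \<zero>\<^bsub>X p\<^esub>"
    using projective_resolution.negative[OF resolution assms(1)] by auto
  interpret Xp: left_module "A\<lparr>carrier := B\<rparr>" "X p" by (rule left_module_X)
  have "T.pure p a x \<oplus>\<^bsub>Z p\<^esub> T.pure p a x = T.pure p a x"
    using T.pure_add_right[of a x p x] pure by (simp add: x)
  then show ?case using pure T.tensor.add.l_cancel_one[of "T.pure p a x" p "T.pure p a x"] by simp
next
  case (diff y z)
  then show ?case by (simp add: a_minus_def T.tensor.r_neg)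
qed

lemma \<iota>_iso: "\<iota> \<in> mod_iso A (regular_module A) (Z 0)"
  unfolding A_iso_def by (rule T.tensor_free_rank_one[OF subring \<beta>])

lemma \<iota>_hom: "\<iota> \<in> mod_hom A (regular_module A) (Z 0)"
  using \<iota>_iso by (simp add: mod_iso_def)

lemma \<iota>_bij: "bij_betw \<iota> (carrier A) (carrier (Z 0))"
  using \<iota>_iso by (simp add: mod_iso_def regular_module_def)

lemmas \<iota>_rules = mod_homD[OF \<iota>_hom, unfolded regular_module_def, simplified]

lemma \<kappa>_\<iota>: "a \<in> carrier A \<Longrightarrow> \<kappa> (\<iota> a) = a"
  by (rule bij_betw_inv_into_left[OF \<iota>_bij])

lemma \<iota>_surj: "z \<in> carrier (Z 0) \<Longrightarrow> \<exists>a\<in>carrier A. z = \<iota> a"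
  using \<iota>_bij by (auto simp: bij_betw_def)

lemma \<beta>_hom: "\<beta> \<in> mod_hom (A\<lparr>carrier := B\<rparr>) (regular_module (A\<lparr>carrier := B\<rparr>)) (X 0)"
  using \<beta> by (simp add: mod_iso_def)

lemmas \<beta>_rules = mod_homD[OF \<beta>_hom, unfolded regular_module_def, simplified]

text \<open>Under \<open>Z\<^sub>0 = A\<close> the pure tensors become products; this is how the image of \<open>D\<^sub>1\<close> is computed as
  a left ideal of \<open>A\<close>.\<close>

lemma pure_\<beta>:
  assumes "a \<in> carrier A" "b \<in> B" shows "T.pure 0 a (\<beta> b) = \<iota> (a \<otimes> b)"
proof -
  have "\<beta> b = b \<odot>\<^bsub>X 0\<^esub> \<beta> \<one>"
    using \<beta>_rules(3)[OF assms(2) B_closed(3)] assms(2) B_closed(1) by (auto simp: subsetD)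
  then show ?thesis
    using T.pure_balanced[OF assms \<beta>_rules(1)[OF B_closed(3)]] assms B_closed(1)
    by (auto simp: A_iso_def)
qed

lemma scalar_closed: "c \<odot>\<^bsub>A\<^esub> \<one> \<in> B"
  using subalgebra B_closed(3) by (simp add: complex_subalgebra_def)

lemma scalar_central:
  assumes "a \<in> carrier A" shows "(c \<odot>\<^bsub>A\<^esub> \<one>) \<otimes> a = a \<otimes> (c \<odot>\<^bsub>A\<^esub> \<one>)"
  using associative_algebra.smult_mult_left[OF algebra, of c \<one> a]
    associative_algebra.smult_mult_right[OF algebra, of c a \<one>] assms
  by (simp add: complex_ring_def)

text \<open>The splitting \<open>B = ker \<epsilon> \<oplus> \<complex> 1\<close>.\<close>

lemma kernel_decomposition:
  assumes "b \<in> B"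
  shows "b \<ominus> \<epsilon> b \<odot>\<^bsub>A\<^esub> \<one> \<in> B" and "\<epsilon> (b \<ominus> \<epsilon> b \<odot>\<^bsub>A\<^esub> \<one>) = 0"
    and "b = (b \<ominus> \<epsilon> b \<odot>\<^bsub>A\<^esub> \<one>) \<oplus> \<epsilon> b \<odot>\<^bsub>A\<^esub> \<one>"
proof -
  let ?s = "\<epsilon> b \<odot>\<^bsub>A\<^esub> \<one>"
  have s: "?s \<in> B" by (rule scalar_closed)
  have carr: "b \<in> carrier A" "?s \<in> carrier A" using assms s B_closed(1) by auto
  show e: "b \<ominus> ?s \<in> B" using assms s B_closed(5,7) by (simp add: a_minus_def)
  show sum: "b = (b \<ominus> ?s) \<oplus> ?s" using carr by (simp add: a_minus_def a_assoc l_neg)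
  have \<epsilon>_add: "\<epsilon> (x \<oplus> y) = \<epsilon> x + \<epsilon> y" if "x \<in> B" "y \<in> B" for x y
    using character that by (auto simp: character_def ring_hom_def complex_ring_def)
  have "\<epsilon> \<one> = 1" using character by (auto simp: character_def ring_hom_def complex_ring_def)
  then have "\<epsilon> ?s = \<epsilon> b"
    using character B_closed(3) by (simp add: character_def)
  then show "\<epsilon> (b \<ominus> ?s) = 0" using \<epsilon>_add[OF e s] sum by simp
qed

end

section \<open>Invariant vectors as cocycles\<close>

locale dirac_reduction_module = dirac_reduction A B \<epsilon> X d aug \<beta> + V: left_module A V
  for A :: "(complex, 'a) module" (structure) and B \<epsilon> and X :: "int \<Rightarrow> ('a, 'x) module"
    and d aug \<beta> and V :: "('a, 'v) module"
begin

abbreviation VB where "VB \<equiv> invariants A B \<epsilon> V"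
abbreviation orbit where "orbit \<equiv> orbit_cocycle A B X \<beta> V"

lemma orbit_\<iota>: "a \<in> carrier A \<Longrightarrow> orbit v (\<iota> a) = a \<odot>\<^bsub>V\<^esub> v"
  by (simp add: orbit_cocycle_def \<iota>_rules(1) \<kappa>_\<iota>)

lemma orbit_hom:
  assumes "v \<in> carrier V" shows "orbit v \<in> mod_hom A (Z 0) V"
proof -
  have "orbit v z \<in> carrier V" if "z \<in> carrier (Z 0)" for z
    using \<iota>_surj[OF that] assms by (auto simp: orbit_\<iota>)
  moreover have "orbit v (y \<oplus>\<^bsub>Z 0\<^esub> z) = orbit v y \<oplus>\<^bsub>V\<^esub> orbit v z"
    if "y \<in> carrier (Z 0)" "z \<in> carrier (Z 0)" for y z
    using \<iota>_surj[OF that(1)] \<iota>_surj[OF that(2)] assms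
    by (auto simp: orbit_\<iota> V.smult_l_distr simp flip: \<iota>_rules(2))
  moreover have "orbit v (r \<odot>\<^bsub>Z 0\<^esub> z) = r \<odot>\<^bsub>V\<^esub> orbit v z"
    if "r \<in> carrier A" "z \<in> carrier (Z 0)" for r z
    using \<iota>_surj[OF that(2)] that(1) assms
    by (auto simp: orbit_\<iota> V.smult_assoc1 simp flip: \<iota>_rules(3))
  moreover have "orbit v \<in> extensional (carrier (Z 0))" by (simp add: orbit_cocycle_def)
  ultimately show ?thesis by (simp add: mod_hom_def PiE_iff)
qed

text \<open>A homomorphism out of the free module \<open>Z\<^sub>0\<close> is determined by its value at the generator.\<close>

lemma hom_eq_orbit:
  assumes "\<psi> \<in> mod_hom A (Z 0) V" shows "\<psi> = orbit (\<psi> (\<iota> \<one>))"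
proof (rule extensionalityI[of _ "carrier (Z 0)"])
  show "\<psi> \<in> extensional (carrier (Z 0))" by (rule mod_hom_extensional[OF assms])
  show "orbit (\<psi> (\<iota> \<one>)) \<in> extensional (carrier (Z 0))" by (simp add: orbit_cocycle_def)
  fix z assume "z \<in> carrier (Z 0)"
  then obtain a where a: "a \<in> carrier A" "z = \<iota> a" using \<iota>_surj by blast
  then have "\<psi> z = a \<odot>\<^bsub>V\<^esub> \<psi> (\<iota> \<one>)"
    using mod_homD(3)[OF assms a(1) \<iota>_rules(1)[OF one_closed]] \<iota>_rules(3)[OF a(1) one_closed] by simp
  then show "\<psi> z = orbit (\<psi> (\<iota> \<one>)) z" using a by (simp add: orbit_\<iota>)
qed

text \<open>The image of \<open>D\<^sub>1\<close> is spanned by the products \<open>a b\<close> with \<open>\<epsilon> b = 0\<close>, and such a \<open>b\<close> annihilates an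
  invariant vector.\<close>

lemma invariant_orbit_cocycle:
  assumes v: "v \<in> VB" and z: "z \<in> carrier (Z 1)"
  shows "orbit v (D 1 z) = \<zero>\<^bsub>V\<^esub>"
proof -
  have vV: "v \<in> carrier V" using v by (simp add: invariants_def)
  show ?thesis
    using z
  proof (induction z rule: T.tensor_induct)
    case (pure a y)
    have dy: "d 1 y \<in> carrier (X 0)" "aug (d 1 y) = 0"
      using projective_resolution.exact_0[OF resolution] pure by (auto simp: character_module_def)
    then obtain b where b: "b \<in> B" "d 1 y = \<beta> b"
      using \<beta> by (auto simp: mod_iso_def bij_betw_def regular_module_def)
    then have "\<epsilon> b = 0" using dy aug_\<beta> by simp
    then have "b \<odot>\<^bsub>V\<^esub> v = (0 \<odot>\<^bsub>A\<^esub> \<one>) \<odot>\<^bsub>V\<^esub> v"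
      using v b by (simp add: invariants_def)
    also have "0 \<odot>\<^bsub>A\<^esub> \<one> = \<zero>"
      using module.smult_l_null[of complex_ring A \<one>] algebra
      by (simp add: associative_algebra_def complex_ring_def)
    finally have bv: "b \<odot>\<^bsub>V\<^esub> v = \<zero>\<^bsub>V\<^esub>" using vV by simp
    have "D 1 (T.pure 1 a y) = \<iota> (a \<otimes> b)"
      using D_pure[of a y 1] pure b pure_\<beta>[of a b] by simp
    then show ?case
      using pure b B_closed(1) vV by (auto simp: orbit_\<iota> V.smult_assoc1 bv)
  next
    case (diff y z)
    have D: "D 1 w \<in> carrier (Z 0)" if "w \<in> carrier (Z 1)" for w
      using mod_homD(1)[OF D_hom that] by simp
    have "D 1 (y \<ominus>\<^bsub>Z 1\<^esub> z) = D 1 y \<ominus>\<^bsub>Z 0\<^esub> D 1 z"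
      using abelian_group_homD(2)[OF T.abelian_group_tensor T.abelian_group_tensor
          mod_hom_additive[OF D_hom] diff(1,2)] by simp
    then show ?case
      using abelian_group_homD(2)[OF T.abelian_group_tensor V.abelian_group_axioms
          mod_hom_additive[OF orbit_hom[OF vV]] D[OF diff(1)] D[OF diff(2)]] diff(3,4)
      by (simp add: a_minus_def V.r_neg)
  qed
qed

text \<open>Conversely, for \<open>e\<close> in the kernel of \<open>\<epsilon>\<close> the element \<open>\<beta> e\<close> is a boundary by exactness at \<open>X\<^sub>0\<close>. So
  \<open>e\<close> lies in the image of \<open>D\<^sub>1\<close> and a cocycle sends it to zero, that is, \<open>e\<close> annihilates the value of
  the cocycle at \<open>1\<close>. The remaining part of \<open>B\<close> consists of scalars.\<close>

lemma cocycle_value_invariant: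
  assumes \<psi>: "\<psi> \<in> mod_hom A (Z 0) V" and cocycle: "\<And>z. z \<in> carrier (Z 1) \<Longrightarrow> \<psi> (D 1 z) = \<zero>\<^bsub>V\<^esub>"
  shows "\<psi> (\<iota> \<one>) \<in> VB"
proof -
  let ?w = "\<psi> (\<iota> \<one>)"
  have w: "?w \<in> carrier V" using mod_homD(1)[OF \<psi> \<iota>_rules(1)[OF one_closed]] .
  have "b \<odot>\<^bsub>V\<^esub> ?w = (\<epsilon> b \<odot>\<^bsub>A\<^esub> \<one>) \<odot>\<^bsub>V\<^esub> ?w" if b: "b \<in> B" for b
  proof -
    let ?s = "\<epsilon> b \<odot>\<^bsub>A\<^esub> \<one>"
    let ?e = "b \<ominus> ?s"
    note e = kernel_decomposition[OF b]
    have carr: "?e \<in> carrier A" "?s \<in> carrier A" using e(1) scalar_closed B_closed(1) by auto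
    have "\<beta> ?e \<in> d 1 ` carrier (X 1)"
      using projective_resolution.exact_0[OF resolution] \<beta>_rules(1)[OF e(1)] aug_\<beta>[OF e(1)] e(2)
      by (simp add: character_module_def)
    then obtain y where y: "y \<in> carrier (X 1)" "\<beta> ?e = d 1 y" by blast
    have "\<iota> ?e = D 1 (T.pure 1 \<one> y)"
      using D_pure[OF one_closed y(1)] y(2) pure_\<beta>[OF one_closed e(1)] carr(1) by simp
    then have "?e \<odot>\<^bsub>V\<^esub> ?w = \<zero>\<^bsub>V\<^esub>"
      using cocycle[of "T.pure 1 \<one> y"] y(1) orbit_\<iota>[OF carr(1), of ?w] hom_eq_orbit[OF \<psi>]
      by simp
    then show ?thesis
      using V.smult_l_distr[OF carr w] carr w e(3)[symmetric] by simp
  qed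
  then show ?thesis using w by (simp add: invariants_def)
qed

text \<open>A coboundary in degree zero factors through \<open>D\<^sub>0\<close>, whose target \<open>Z\<^sub>-\<^sub>1\<close> is zero. Hence the class
  of a cocycle is just that cocycle, and \<open>V\<^sup>B\<close> embeds into \<open>H\<^sup>0(V)\<close>.\<close>

lemma Ext0_class:
  assumes \<phi>: "\<phi> \<in> mod_hom A (Z 0) V"
  shows "Ext_class A B X d V 0 \<phi> = {\<phi>}"
proof -
  let ?C = "Hom_group A Z V"
  have "Hom_diff Z D (- 1) \<psi> \<otimes>\<^bsub>?C 0\<^esub> \<phi> = \<phi>" if \<psi>: "\<psi> \<in> mod_hom A (Z (- 1)) V" for \<psi>
  proof (rule extensionalityI[of _ "carrier (Z 0)"])
    show "Hom_diff Z D (- 1) \<psi> \<otimes>\<^bsub>?C 0\<^esub> \<phi> \<in> extensional (carrier (Z 0))"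
      by (simp add: Hom_group_def)
    show "\<phi> \<in> extensional (carrier (Z 0))" by (rule mod_hom_extensional[OF \<phi>])
    fix z assume z: "z \<in> carrier (Z 0)"
    have "D 0 z = \<zero>\<^bsub>Z (- 1)\<^esub>"
      using Z_negative[of "- 1" "D 0 z"] mod_homD(1)[OF D_hom z] by simp
    then show "(Hom_diff Z D (- 1) \<psi> \<otimes>\<^bsub>?C 0\<^esub> \<phi>) z = \<phi> z"
      using z mod_hom_zero[OF T.left_module_tensor V.left_module_axioms \<psi>] mod_homD(1)[OF \<phi> z]
      by (simp add: Hom_group_def Hom_diff_def compose_def)
  qed
  moreover have "mod_hom A (Z (- 1)) V \<noteq> {}"
    using zero_mod_hom[OF T.left_module_tensor V.left_module_axioms] by blast
  ultimately show ?thesis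
    by (auto simp: Ext_class_def cohomology_class_def coboundaries_def r_coset_def Hom_group_def[of _ _ _ "- 1"])
qed

lemma invariant_class_inj: "inj_on (invariant_class A B X d \<beta> V) VB"
proof (rule inj_onI)
  fix v w assume v: "v \<in> VB" and w: "w \<in> VB"
    and "invariant_class A B X d \<beta> V v = invariant_class A B X d \<beta> V w"
  then have "orbit v (\<iota> \<one>) = orbit w (\<iota> \<one>)"
    by (simp add: invariant_class_def Ext0_class orbit_hom invariants_def)
  then show "v = w" using v w by (simp add: orbit_\<iota> invariants_def)
qed

section \<open>The action of the Hecke algebra in degree zero\<close>

lemma Hk0_cocycleD:
  assumes f: "f \<in> Hk_cocycles A B X d 0"
  shows "f p \<in> mod_hom A (Z p) (Z p)"
    and "z \<in> carrier (Z 1) \<Longrightarrow> f 0 (D 1 z) = D 1 (f 1 z)"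
proof -
  have hom: "f p \<in> mod_hom A (Z p) (Z p)" for p
    using f by (auto simp: Hk_cocycles_def cocycles_def kernel_def End_group_def)
  then show "f p \<in> mod_hom A (Z p) (Z p)" .
  assume z: "z \<in> carrier (Z 1)"
  have "End_diff Z D 0 f 1 z = \<one>\<^bsub>End_group A Z 1\<^esub> 1 z"
    using f by (simp add: Hk_cocycles_def cocycles_def kernel_def)
  then have "D 1 (f 1 z) \<ominus>\<^bsub>Z 0\<^esub> f 0 (D 1 z) = \<zero>\<^bsub>Z 0\<^esub>"
    using z by (simp add: End_diff_def End_group_def)
  moreover have "D 1 (f 1 z) \<in> carrier (Z 0)" "f 0 (D 1 z) \<in> carrier (Z 0)"
    using mod_homD(1)[OF D_hom mod_homD(1)[OF hom z]] mod_homD(1)[OF hom, of "D 1 z" 0]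
      mod_homD(1)[OF D_hom z] by simp_all
  ultimately show "f 0 (D 1 z) = D 1 (f 1 z)"
    using T.tensor.add.inv_solve_right'[of "\<zero>\<^bsub>Z 0\<^esub>" 0] by (simp add: a_minus_def)
qed

text \<open>Another representative differs from \<open>f\<close> in degree zero by \<open>D\<^sub>1 k\<^sub>0 + k\<^sub>-\<^sub>1 D\<^sub>0\<close>. The first summand
  is killed by the cocycle of \<open>v\<close>, the second factors through \<open>Z\<^sub>-\<^sub>1 = 0\<close>.\<close>

lemma orbit_on_Hk0_class:
  assumes v: "v \<in> VB" and f: "f \<in> Hk_cocycles A B X d 0"
    and g: "g \<in> Hk_class A B X d 0 f" and z: "z \<in> carrier (Z 0)"
  shows "orbit v (g 0 z) = orbit v (f 0 z)"
proof -
  have vV: "v \<in> carrier V" using v by (simp add: invariants_def)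
  obtain k where k: "k \<in> carrier (End_group A Z (- 1))"
    and g_eq: "g = End_diff Z D (- 1) k \<otimes>\<^bsub>End_group A Z 0\<^esub> f"
    using g by (auto simp: Hk_class_def cohomology_class_def coboundaries_def r_coset_def)
  have k_hom: "k p \<in> mod_hom A (Z p) (Z (p + 1))" for p
    using k by (simp add: End_group_def)
  have D0: "D 0 z = \<zero>\<^bsub>Z (- 1)\<^esub>"
    using Z_negative[of "- 1" "D 0 z"] mod_homD(1)[OF D_hom z] by simp
  have kz: "k 0 z \<in> carrier (Z 1)" using mod_homD(1)[OF k_hom z] by simp
  have "k (- 1) (D 0 z) = \<zero>\<^bsub>Z 0\<^esub>"
    using mod_hom_zero[OF T.left_module_tensor T.left_module_tensor k_hom[of "- 1"]] D0 by simp
  moreover have Dk: "D 1 (k 0 z) \<in> carrier (Z 0)" using mod_homD(1)[OF D_hom kz] by simp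
  ultimately have "g 0 z = D 1 (k 0 z) \<oplus>\<^bsub>Z 0\<^esub> f 0 z"
    using z by (simp add: g_eq End_group_def End_diff_def)
  moreover have "f 0 z \<in> carrier (Z 0)" by (rule mod_homD(1)[OF Hk0_cocycleD(1)[OF f] z])
  ultimately show ?thesis
    using mod_homD(2)[OF orbit_hom[OF vV] Dk] invariant_orbit_cocycle[OF v kz]
      mod_homD(1)[OF orbit_hom[OF vV]] by simp
qed

lemma Hk0_class_nonempty: "Hk_class A B X d 0 f \<noteq> {}"
proof -
  have "(\<lambda>p. \<lambda>z\<in>carrier (Z p). \<zero>\<^bsub>Z (p + 1)\<^esub>) \<in> carrier (End_group A Z (- 1))"
    using zero_mod_hom[OF T.left_module_tensor T.left_module_tensor] by (simp add: End_group_def)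
  then show ?thesis
    by (auto simp: Hk_class_def cohomology_class_def coboundaries_def r_coset_def)
qed

lemma component00_represents:
  assumes f: "f \<in> Hk_cocycles A B X d 0"
  shows "component00 A B X \<beta> f \<one> \<in> carrier A"
    and "\<iota> (component00 A B X \<beta> f \<one>) = f 0 (\<iota> \<one>)"
proof -
  have "f 0 (\<iota> \<one>) \<in> carrier (Z 0)"
    by (rule mod_homD(1)[OF Hk0_cocycleD(1)[OF f] \<iota>_rules(1)[OF one_closed]])
  then obtain a where "a \<in> carrier A" "f 0 (\<iota> \<one>) = \<iota> a" using \<iota>_surj by blast
  then show "component00 A B X \<beta> f \<one> \<in> carrier A" "\<iota> (component00 A B X \<beta> f \<one>) = f 0 (\<iota> \<one>)"
    by (simp_all add: component00_def \<kappa>_\<iota>)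
qed

text \<open>The heart of the matter: since \<open>f\<close> commutes with the differential, composition with \<open>f\<^sub>0\<close> preserves
  cocycles, and on the corresponding invariant vectors it is \<open>v \<mapsto> a v\<close>.\<close>

lemma orbit_compose_cocycle:
  assumes v: "v \<in> VB" and f: "f \<in> Hk_cocycles A B X d 0"
  defines "a \<equiv> component00 A B X \<beta> f \<one>"
  shows "a \<odot>\<^bsub>V\<^esub> v \<in> VB" and "compose (carrier (Z 0)) (orbit v) (f 0) = orbit (a \<odot>\<^bsub>V\<^esub> v)"
proof -
  have vV: "v \<in> carrier V" using v by (simp add: invariants_def)
  let ?\<psi> = "compose (carrier (Z 0)) (orbit v) (f 0)"
  have \<psi>: "?\<psi> \<in> mod_hom A (Z 0) V"
    by (rule mod_hom_compose[OF orbit_hom[OF vV] Hk0_cocycleD(1)[OF f] T.left_module_tensor])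
  have at_one: "?\<psi> (\<iota> \<one>) = a \<odot>\<^bsub>V\<^esub> v"
    using orbit_\<iota>[OF component00_represents(1)[OF f], of v] component00_represents(2)[OF f] \<iota>_rules(1)
    by (simp add: compose_def a_def)
  have "?\<psi> (D 1 z) = \<zero>\<^bsub>V\<^esub>" if z: "z \<in> carrier (Z 1)" for z
    using Hk0_cocycleD(2)[OF f z] mod_homD(1)[OF D_hom z]
      invariant_orbit_cocycle[OF v mod_homD(1)[OF Hk0_cocycleD(1)[OF f] z]]
    by (simp add: compose_def)
  then show "a \<odot>\<^bsub>V\<^esub> v \<in> VB" using cocycle_value_invariant[OF \<psi>] at_one by simp
  show "?\<psi> = orbit (a \<odot>\<^bsub>V\<^esub> v)" using hom_eq_orbit[OF \<psi>] at_one by simp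
qed

text \<open>The unions over representatives that define the action are constant, so they reduce to the single
  class of \<open>orbit (a v)\<close>, from which injectivity recovers the vector \<open>a v\<close>.\<close>

lemma Hk0_act_eq:
  assumes v: "v \<in> VB" and f: "f \<in> Hk_cocycles A B X d 0"
  shows "Hk0_act A B X d \<epsilon> \<beta> V (Hk_class A B X d 0 f) v = component00 A B X \<beta> f \<one> \<odot>\<^bsub>V\<^esub> v"
proof -
  let ?w = "component00 A B X \<beta> f \<one> \<odot>\<^bsub>V\<^esub> v"
  have orbit_in: "orbit u \<in> mod_hom A (Z 0) V" if "u \<in> VB" for u
    using that orbit_hom by (simp add: invariants_def)
  have "compose (carrier (Z 0)) (orbit v) (g 0) = orbit ?w" if "g \<in> Hk_class A B X d 0 f" for g
    unfolding orbit_compose_cocycle(2)[OF v f, symmetric] compose_def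
    by (rule restrict_ext) (rule orbit_on_Hk0_class[OF v f that])
  then have "Ext_act A B X d V 0 0 (invariant_class A B X d \<beta> V v) (Hk_class A B X d 0 f)
      = Ext_class A B X d V 0 (orbit ?w)"
    by (simp add: Ext_act_def invariant_class_def Ext0_class orbit_in[OF v] Hk0_class_nonempty)
  then show ?thesis
    using inv_into_f_f[OF invariant_class_inj orbit_compose_cocycle(1)[OF v f]]
    by (simp add: Hk0_act_def invariant_class_def)
qed

text \<open>Dirac's condition says no more than that \<open>a\<close> preserves invariance: \<open>b\<close> acts on both \<open>v\<close> and \<open>a v\<close>
  by the scalar \<open>\<epsilon> b\<close>, which commutes with \<open>a\<close>.\<close>

lemma dirac_condition_of_invariant:
  assumes a: "a \<in> carrier A" and inv: "\<And>v. v \<in> VB \<Longrightarrow> a \<odot>\<^bsub>V\<^esub> v \<in> VB"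
  shows "dirac_condition A B \<epsilon> V a"
  unfolding dirac_condition_def
proof (intro ballI)
  fix b v assume b: "b \<in> B" and v: "v \<in> VB"
  let ?s = "\<epsilon> b \<odot>\<^bsub>A\<^esub> \<one>"
  have carr: "b \<in> carrier A" "?s \<in> carrier A" "v \<in> carrier V"
    using b scalar_closed B_closed(1) v by (auto simp: invariants_def)
  have "(b \<otimes> a) \<odot>\<^bsub>V\<^esub> v = ?s \<odot>\<^bsub>V\<^esub> (a \<odot>\<^bsub>V\<^esub> v)"
    using inv[OF v] b carr a by (simp add: V.smult_assoc1 invariants_def)
  also have "\<dots> = (a \<otimes> ?s) \<odot>\<^bsub>V\<^esub> v"
    using scalar_central[OF a, of "\<epsilon> b"] V.smult_assoc1[of ?s a v] carr a by simp
  also have "\<dots> = (a \<otimes> b) \<odot>\<^bsub>V\<^esub> v"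
    using v b carr a by (simp add: V.smult_assoc1 invariants_def)
  finally have eq: "(b \<otimes> a) \<odot>\<^bsub>V\<^esub> v = (a \<otimes> b) \<odot>\<^bsub>V\<^esub> v" .
  have "((b \<otimes> a \<ominus> a \<otimes> b) \<oplus> a \<otimes> b) \<odot>\<^bsub>V\<^esub> v
      = (b \<otimes> a \<ominus> a \<otimes> b) \<odot>\<^bsub>V\<^esub> v \<oplus>\<^bsub>V\<^esub> (a \<otimes> b) \<odot>\<^bsub>V\<^esub> v"
    using carr a by (intro V.smult_l_distr) auto
  moreover have "(b \<otimes> a \<ominus> a \<otimes> b) \<oplus> a \<otimes> b = b \<otimes> a"
    using carr a by (simp add: a_minus_def a_assoc l_neg)
  ultimately show "(b \<otimes> a \<ominus> a \<otimes> b) \<odot>\<^bsub>V\<^esub> v = \<zero>\<^bsub>V\<^esub>"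
    using eq carr a V.add.r_cancel_one' by simp
qed

end

theorem theorem9:
  fixes A :: "(complex, 'a) module"
    and B :: "'a set"
    and \<epsilon> :: "'a \<Rightarrow> complex"
    and X :: "int \<Rightarrow> ('a, 'x) module"
    and d :: "int \<Rightarrow> 'x \<Rightarrow> 'x"
    and aug :: "'x \<Rightarrow> complex"
    and \<beta> :: "'a \<Rightarrow> 'x"
    and f :: "int \<Rightarrow> (('a \<times> 'x) \<Rightarrow>\<^sub>0 int) set \<Rightarrow> (('a \<times> 'x) \<Rightarrow>\<^sub>0 int) set"
    and a :: 'a
    and V :: "('a, 'v) module"
  assumes A: "complex_algebra A"
    and B: "complex_subalgebra B A"
    and \<epsilon>: "character A B \<epsilon>"
    and X: "projective_resolution (A\<lparr>carrier := B\<rparr>) (character_module \<epsilon>) X d aug"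
    and X0: "\<beta> \<in> mod_iso (A\<lparr>carrier := B\<rparr>) (regular_module (A\<lparr>carrier := B\<rparr>)) (X 0)"
    and aug: "\<And>b. b \<in> B \<Longrightarrow> aug (\<beta> b) = \<epsilon> b"
    and c: "c \<in> carrier (opposite (Hk0 A B X d))"
    and f: "f \<in> Hk_cocycles A B X d 0" "c = Hk_class A B X d 0 f"
    and a: "a = component00 A B X \<beta> f \<one>\<^bsub>A\<^esub>"
    and V: "left_module A V"
  shows "a \<in> carrier A \<and>
    (\<forall>v\<in>invariants A B \<epsilon> V.
       a \<odot>\<^bsub>V\<^esub> v \<in> invariants A B \<epsilon> V \<and> Hk0_act A B X d \<epsilon> \<beta> V c v = a \<odot>\<^bsub>V\<^esub> v) \<and>
    dirac_condition A B \<epsilon> V a"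
proof -
  interpret dirac_reduction_module A B \<epsilon> X d aug \<beta> V
    by (intro dirac_reduction_module.intro dirac_reduction.intro A B \<epsilon> X X0 aug V)
  show ?thesis
    unfolding a f(2)
    using component00_represents(1)[OF f(1)] orbit_compose_cocycle(1)[OF _ f(1)] Hk0_act_eq[OF _ f(1)]
      dirac_condition_of_invariant by simp
qed

end
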